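(* For all positive integers $n$ we have $\kappa(S_n) \le C_\kappa/n^2$, where $C_\kappa = 13^2\,\kappa(S_{13})$.
   Context: $S_n$ is the symmetric group of degree $n$. For a finite group $G$, $\kappa(G)$ denotes the probability that $g$ and $h$ are conjugate in $G$, when $g,h\in G$ are chosen independently and uniformly at random from $G$. *)

theory Defs
  imports "HOL-Algebra.Sym_Groups" "HOL-Probability.Probability_Mass_Function"
begin

definition conjugate_in :: "('a, 'b) monoid_scheme \<Rightarrow> 'a \<Rightarrow> 'a \<Rightarrow> bool" where
  "conjugate_in G g h \<longleftrightarrow>
     g \<in> carrier G \<and> h \<in> carrier G \<and>
     (\<exists>x\<in>carrier G. h = x \<otimes>\<^bsub>G\<^esub> g \<otimes>\<^bsub>G\<^esub> inv\<^bsub>G\<^esub> x)"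

(* Meaningful only for finite G, since pmf_of_set is unspecified on infinite sets. *)
definition kappa :: "('a, 'b) monoid_scheme \<Rightarrow> real" where
  "kappa G =
     measure_pmf.prob (pair_pmf (pmf_of_set (carrier G)) (pmf_of_set (carrier G)))
       {(g, h). conjugate_in G g h}"

definition C_kappa :: real where
  "C_kappa = 13\<^sup>2 * kappa (sym_group 13)"

end

theory Submission
  imports Defs "HOL-Combinatorics.Orbits"
begin

text \<open>
Conjugacy in the symmetric group is equality of cycle types, and a permutation of \<open>n\<close> points with
\<open>c l\<close> cycles of each length \<open>l\<close> has a centralizer of order \<open>z(c) = (\<Prod>l. l ^ c l * c l!)\<close>. The class of
type \<open>c\<close> therefore has probability \<open>1 / z(c)\<close>, and \<open>kappa(S\<^sub>n)\<close> is the sum of \<open>1 / z(c)\<^sup>2\<close> over all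
types \<open>c\<close> of \<open>n\<close> (\<open>kappa_sym_group\<close>). Class sizes and the conjugacy criterion both come from one
count: the number of bijections that intertwine two permutations of the same cycle type is \<open>z(c)\<close>
(\<open>card_intertwiners\<close>).

Write \<open>K k n\<close> (\<open>kappa_parts\<close>) for the part of the sum in which all cycles have length at most \<open>k\<close>.
Deleting one cycle of length \<open>l\<close> divides \<open>z(c)\<close> by \<open>l * c l\<close>, and this gives two inequalities.
A type with a cycle longer than \<open>k\<close> is charged to the types left after deleting it:
\<open>K n n \<le> K k n + (\<Sum>l=k+1..n. K (n-l) (n-l) / l\<^sup>2)\<close>. Counting points by the length of their cycle
gives \<open>n * K k n \<le> (\<Sum>l=1..k. K k (n-l) / l)\<close>, so that \<open>K k n\<close> is small when \<open>k\<close> is fixed.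

The bound \<open>K n n \<le> C / n\<^sup>2\<close> with \<open>C = 13\<^sup>2 K 13 13\<close> follows by induction. For \<open>n \<ge> 56\<close> take \<open>k = 21\<close>.
Two uses of the averaging inequality turn the induction hypothesis into
\<open>n\<^sup>2 K 21 n \<le> 0.015 C\<close>. In the sum over \<open>l\<close>, the terms with \<open>m = n - l \<le> 5\<close> contribute at most \<open>3.5205\<close>
after multiplication by \<open>n\<^sup>2\<close>, because the first values \<open>K m m\<close> are known; the remaining terms are
at most \<open>C (1/m + 1/l)\<^sup>2\<close> by the induction hypothesis, and add up to less than \<open>0.325 C\<close>. As
\<open>C > 5.4835\<close>, the total is below \<open>C\<close>. For \<open>n \<le> 55\<close> the values \<open>K n n\<close> are computed with integer
arithmetic, rounded up for every \<open>n\<close>, and rounded down for the value \<open>K 13 13\<close> that defines \<open>C\<close>.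
The margin is smallest at \<open>n = 12\<close>, where \<open>n\<^sup>2 K n n\<close> is about \<open>0.99988 C\<close>.
\<close>

section \<open>Orbits and cycle types\<close>

lemma orbit_eq_of_mem:
  assumes "permutation p" "y \<in> orbit p x"
  shows "orbit p y = orbit p x"
  using orbit_cyclic_eq3[OF cyclic_on_orbit'[OF assms(1)] assms(2)] .

lemma orbit_subset_invariant:
  assumes "p ` A \<subseteq> A" "x \<in> A"
  shows "orbit p x \<subseteq> A"
proof
  fix y assume "y \<in> orbit p x"
  then show "y \<in> A" using assms by induct auto
qed

lemma funpow_eq_iff_mod_card_orbit:
  assumes "permutation p"
  shows "(p ^^ i) a = (p ^^ j) a \<longleftrightarrow> i mod card (orbit p a) = j mod card (orbit p a)"
proof -
  have self: "a \<in> orbit p a"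
    using assms by (rule permutation_self_in_orbit)
  define l where "l = funpow_dist1 p a a"
  have period: "(p ^^ l) a = a"
    unfolding l_def by (rule funpow_dist1_prop[OF self])
  have inj: "inj_on (\<lambda>n. (p ^^ n) a) {0..<l}"
    unfolding l_def by (rule inj_on_funpow_dist1[OF self])
  have card: "card (orbit p a) = l"
    using orbit_conv_funpow_dist1[OF self] card_image[OF inj] by (simp add: l_def)
  have "l > 0" by (simp add: l_def)
  have "(p ^^ i) a = (p ^^ j) a \<longleftrightarrow> (p ^^ (i mod l)) a = (p ^^ (j mod l)) a"
    by (simp add: funpow_mod_eq[OF period])
  also have "\<dots> \<longleftrightarrow> i mod l = j mod l"
    using inj_onD[OF inj, of "i mod l" "j mod l"] \<open>l > 0\<close> by auto
  finally show ?thesis by (simp add: card)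
qed

definition cycle_type :: "('a \<Rightarrow> 'a) \<Rightarrow> 'a set \<Rightarrow> nat \<Rightarrow> nat" where
  "cycle_type p A l = card {S \<in> orbit p ` A. card S = l}"

lemma cycle_type_remove_orbit:
  assumes p: "permutation p" and "finite A" and a: "a \<in> A"
  shows "cycle_type p A (card (orbit p a)) > 0"
    and "cycle_type p (A - orbit p a)
         = (cycle_type p A)(card (orbit p a) := cycle_type p A (card (orbit p a)) - 1)"
proof -
  let ?O = "orbit p a"
  have self: "x \<in> orbit p x" for x using p by (rule permutation_self_in_orbit)
  have split: "orbit p ` A = insert ?O (orbit p ` (A - ?O))"
    using a orbit_eq_of_mem[OF p] by auto
  have notin: "?O \<notin> orbit p ` (A - ?O)"
    using self by auto
  have fin: "finite (orbit p ` (A - ?O))" using \<open>finite A\<close> by simp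
  have eq: "{S \<in> orbit p ` A. card S = l} =
        (if l = card ?O then insert ?O {S \<in> orbit p ` (A - ?O). card S = l}
         else {S \<in> orbit p ` (A - ?O). card S = l})" for l
    unfolding split by auto
  have step: "cycle_type p A l = cycle_type p (A - ?O) l + (if l = card ?O then 1 else 0)" for l
    unfolding cycle_type_def eq using fin notin by (simp del: image_iff)
  show "cycle_type p A (card ?O) > 0" by (simp add: step)
  show "cycle_type p (A - ?O) = (cycle_type p A)(card ?O := cycle_type p A (card ?O) - 1)"
    by (rule ext) (simp add: step)
qed

text \<open>Points are counted through their orbits, which are disjoint.\<close>

lemma card_points_in_orbits:
  assumes p: "permutation p" and "finite A" and inv: "p ` A \<subseteq> A"
  shows "card {x \<in> A. card (orbit p x) = l} = l * cycle_type p A l"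
proof -
  let ?T = "{S \<in> orbit p ` A. card S = l}"
  have self: "x \<in> orbit p x" for x using p by (rule permutation_self_in_orbit)
  have sub: "orbit p x \<subseteq> A" if "x \<in> A" for x using orbit_subset_invariant[OF inv that] .
  have "{x \<in> A. card (orbit p x) = l} = \<Union>?T"
    using self sub orbit_eq_of_mem[OF p] by fastforce
  moreover have "card (\<Union>?T) = sum card ?T"
  proof (rule card_Union_disjoint)
    show "pairwise disjnt ?T"
      unfolding pairwise_def disjnt_def using orbit_eq_of_mem[OF p] by blast
    show "finite S" if "S \<in> ?T" for S
      using that finite_subset[OF sub \<open>finite A\<close>] by auto
  qed
  ultimately show ?thesis by (simp add: cycle_type_def)
qed

lemma cycle_type_range:
  assumes p: "permutation p" and "finite A" and inv: "p ` A \<subseteq> A" and "cycle_type p A l \<noteq> 0"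
  shows "l \<in> {1..card A}"
proof -
  obtain a where a: "a \<in> A" "card (orbit p a) = l"
    using assms(4) by (auto simp: cycle_type_def card_eq_0_iff)
  have sub: "orbit p a \<subseteq> A" using orbit_subset_invariant[OF inv a(1)] .
  then have "card (orbit p a) \<le> card A" "finite (orbit p a)"
    using \<open>finite A\<close> by (auto intro: card_mono finite_subset)
  moreover have "orbit p a \<noteq> {}" by (rule orbit_nonempty)
  ultimately show ?thesis using a by (auto simp: Suc_le_eq card_gt_0_iff)
qed

lemma sum_cycle_type:
  assumes p: "permutation p" and "finite A" and inv: "p ` A \<subseteq> A"
  shows "(\<Sum>l\<in>{1..card A}. l * cycle_type p A l) = card A"
proof -
  have "card A = card (\<Union>l\<in>{1..card A}. {x \<in> A. card (orbit p x) = l})"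
  proof (rule arg_cong[where f = card])
    have "card (orbit p x) \<in> {1..card A}" if "x \<in> A" for x
      using cycle_type_range[OF assms, of "card (orbit p x)"]
        cycle_type_remove_orbit(1)[OF assms(1,2) that] by simp
    then show "A = (\<Union>l\<in>{1..card A}. {x \<in> A. card (orbit p x) = l})" by auto
  qed
  also have "\<dots> = (\<Sum>l\<in>{1..card A}. card {x \<in> A. card (orbit p x) = l})"
    by (rule card_UN_disjoint) (use \<open>finite A\<close> in auto)
  finally show ?thesis using card_points_in_orbits[OF assms] by simp
qed

text \<open>
The order of the centralizer of a permutation with \<open>c l\<close> cycles of each length \<open>l\<close>: each cycle can be
rotated, and cycles of equal length can be permuted among themselves.
\<close>

definition centralizer_order :: "(nat \<Rightarrow> nat) \<Rightarrow> nat" where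
  "centralizer_order c = (\<Prod>l | c l \<noteq> 0. l ^ c l * fact (c l))"

lemma centralizer_order_superset:
  assumes "finite S" "\<And>l. c l \<noteq> 0 \<Longrightarrow> l \<in> S"
  shows "centralizer_order c = (\<Prod>l\<in>S. l ^ c l * fact (c l))"
  unfolding centralizer_order_def
  by (rule prod.mono_neutral_left) (use assms in auto)

lemma centralizer_order_remove:
  assumes "finite {l. c l \<noteq> 0}" "c l > 0"
  shows "centralizer_order c = l * c l * centralizer_order (c(l := c l - 1))"
proof -
  let ?S = "{l. c l \<noteq> 0}" and ?c = "c(l := c l - 1)"
  have l: "l \<in> ?S" using assms by simp
  have "centralizer_order c = (l ^ c l * fact (c l)) * (\<Prod>i\<in>?S - {l}. i ^ c i * fact (c i))"
    unfolding centralizer_order_def using prod.remove[OF assms(1) l] .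
  moreover have "centralizer_order ?c = (\<Prod>i\<in>?S. i ^ ?c i * fact (?c i))"
    by (rule centralizer_order_superset) (use assms in \<open>auto split: if_splits\<close>)
  moreover have "\<dots> = (l ^ (c l - 1) * fact (c l - 1)) * (\<Prod>i\<in>?S - {l}. i ^ c i * fact (c i))"
    by (subst prod.remove[OF assms(1) l]) simp
  moreover have "l ^ c l * fact (c l) = l * c l * (l ^ (c l - 1) * fact (c l - 1))"
    using assms(2) by (cases "c l") (simp_all add: algebra_simps)
  ultimately show ?thesis by (simp add: mult.assoc)
qed

lemma centralizer_order_pos:
  assumes "\<And>l. c l \<noteq> 0 \<Longrightarrow> l > 0"
  shows "centralizer_order c > 0"
  unfolding centralizer_order_def using assms by (auto intro!: prod_pos)

section \<open>Counting intertwining bijections\<close>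

text \<open>
Two underlying sets are allowed, since the induction removes an orbit of \<open>p\<close> from \<open>A\<close> and an
unrelated orbit of \<open>q\<close> from \<open>B\<close>. The maps \<open>p\<close> and \<open>q\<close> themselves stay the same throughout, and only the
invariant sets shrink.
\<close>

definition intertwiners :: "('a \<Rightarrow> 'a) \<Rightarrow> 'a set \<Rightarrow> ('b \<Rightarrow> 'b) \<Rightarrow> 'b set \<Rightarrow> ('a \<Rightarrow> 'b) set" where
  "intertwiners p A q B = {f \<in> A \<rightarrow>\<^sub>E B. bij_betw f A B \<and> (\<forall>x\<in>A. f (p x) = q (f x))}"

lemma intertwiner_funpow:
  assumes "p ` A \<subseteq> A" "\<forall>x\<in>A. f (p x) = q (f x)" "a \<in> A"
  shows "f ((p ^^ i) a) = (q ^^ i) (f a)"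
proof -
  have "(p ^^ i) a \<in> A \<and> f ((p ^^ i) a) = (q ^^ i) (f a)"
    by (induction i) (use assms in auto)
  then show ?thesis ..
qed

lemma intertwiner_image_orbit:
  assumes "permutation p" "permutation q" "p ` A \<subseteq> A" "\<forall>x\<in>A. f (p x) = q (f x)" "a \<in> A"
  shows "f ` orbit p a = orbit q (f a)"
  using intertwiner_funpow[OF assms(3-5)]
  unfolding orbit_altdef_permutation[OF assms(1)] orbit_altdef_permutation[OF assms(2)]
  by (auto simp: image_iff) metis

lemma apply_in_orbit_iff:
  assumes "permutation p"
  shows "p x \<in> orbit p y \<longleftrightarrow> x \<in> orbit p y"
  using assms
  by (metis orbit.step orbit_eq_of_mem orbit.base permutation_orbit_step permutation_self_in_orbit)

text \<open>
An intertwiner is determined on the orbit of \<open>a\<close> by the image \<open>b\<close> of \<open>a\<close>, and on the rest it is an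
arbitrary intertwiner of what is left.
\<close>

lemma bij_betw_restrict_intertwiners:
  assumes p: "permutation p" and q: "permutation q"
    and pA: "p ` A \<subseteq> A" and qB: "q ` B \<subseteq> B" and a: "a \<in> A" and b: "b \<in> B"
    and card: "card (orbit p a) = card (orbit q b)"
  shows "bij_betw (\<lambda>f. restrict f (A - orbit p a)) {f \<in> intertwiners p A q B. f a = b}
           (intertwiners p (A - orbit p a) q (B - orbit q b))"
    (is "bij_betw ?r ?F ?G")
proof -
  let ?O = "orbit p a" and ?P = "orbit q b"
  have OA: "?O \<subseteq> A" and PB: "?P \<subseteq> B"
    using orbit_subset_invariant pA qB a b by metis+
  have O: "?O = range (\<lambda>i. (p ^^ i) a)" and P: "?P = range (\<lambda>i. (q ^^ i) b)"
    using orbit_altdef_permutation p q by (metis full_SetCompr_eq)+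
  have pin: "p x \<in> ?O \<longleftrightarrow> x \<in> ?O" for x
    using p by (rule apply_in_orbit_iff)
  have inj: "inj_on ?r ?F"
  proof (rule inj_onI)
    fix f g assume f: "f \<in> ?F" and g: "g \<in> ?F" and eq: "?r f = ?r g"
    have "f x = g x" for x
    proof (cases "x \<in> ?O")
      case True
      then obtain i where x: "x = (p ^^ i) a" using O by auto
      show ?thesis
        using f g intertwiner_funpow[OF pA _ a, of f q i] intertwiner_funpow[OF pA _ a, of g q i]
        unfolding x intertwiners_def by simp
    next
      case False
      show ?thesis
      proof (cases "x \<in> A")
        case True
        then show ?thesis using False fun_cong[OF eq, of x] by simp
      next
        case False
        then show ?thesis using f g by (auto simp: intertwiners_def PiE_def extensional_def)
      qed
    qed
    then show "f = g" ..
  qed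
  have into: "?r f \<in> ?G" if f: "f \<in> ?F" for f
  proof -
    have im: "f ` ?O = ?P"
      using f intertwiner_image_orbit[OF p q pA _ a, of f] by (simp add: intertwiners_def)
    have bij: "bij_betw f A B" using f by (simp add: intertwiners_def)
    have "f ` (A - ?O) = B - ?P"
      using bij im OA by (metis bij_betw_def inj_on_image_set_diff Diff_subset order_refl)
    moreover have "inj_on f (A - ?O)"
      using bij by (meson Diff_subset bij_betw_def inj_on_subset)
    ultimately have "bij_betw f (A - ?O) (B - ?P)" by (simp add: bij_betw_def)
    moreover have "p x \<in> A - ?O" "f (p x) = q (f x)" if "x \<in> A - ?O" for x
      using that pin[of x] pA f by (auto simp: intertwiners_def)
    ultimately show ?thesis
      by (auto simp: intertwiners_def bij_betw_def inj_on_def)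
  qed
  have onto: "g \<in> ?r ` ?F" if g: "g \<in> ?G" for g
  proof -
    \<comment> \<open>An intertwiner carries \<open>p\<^sup>i a\<close> to \<open>q\<^sup>i b\<close>; this is well defined because the two orbits
       have the same length.\<close>
    define h where "h x = (q ^^ funpow_dist p a x) b" for x
    have h: "h ((p ^^ i) a) = (q ^^ i) b" for i
    proof -
      have "(p ^^ i) a \<in> ?O" using O by auto
      then have "(p ^^ funpow_dist p a ((p ^^ i) a)) a = (p ^^ i) a"
        by (rule funpow_dist_prop)
      then show ?thesis
        unfolding h_def funpow_eq_iff_mod_card_orbit[OF p] funpow_eq_iff_mod_card_orbit[OF q] card .
    qed
    have hbij: "bij_betw h ?O ?P"
    proof (rule bij_betwI')
      show "h x = h y \<longleftrightarrow> x = y" if "x \<in> ?O" "y \<in> ?O" for x y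
      proof -
        obtain i j where "x = (p ^^ i) a" "y = (p ^^ j) a" using \<open>x \<in> ?O\<close> \<open>y \<in> ?O\<close> O by auto
        then show ?thesis
          by (simp add: h funpow_eq_iff_mod_card_orbit[OF p] funpow_eq_iff_mod_card_orbit[OF q] card)
      qed
    next
      show "h x \<in> ?P" if "x \<in> ?O" for x using that O P h by auto
    next
      show "\<exists>x\<in>?O. y = h x" if "y \<in> ?P" for y using that O P h by auto
    qed
    have hq: "h (p x) = q (h x)" if x: "x \<in> ?O" for x
    proof -
      obtain i where "x = (p ^^ i) a" using x O by auto
      then show ?thesis using h[of i] h[of "Suc i"] by simp
    qed
    have gbij: "bij_betw g (A - ?O) (B - ?P)" and gq: "\<forall>x\<in>A - ?O. g (p x) = q (g x)"
      and gE: "g \<in> (A - ?O) \<rightarrow>\<^sub>E (B - ?P)"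
      using g by (auto simp: intertwiners_def)
    define f where "f x = (if x \<in> ?O then h x else g x)" for x
    have "bij_betw f ?O ?P" using hbij by (rule bij_betw_cong[THEN iffD1, rotated]) (simp add: f_def)
    moreover have "bij_betw f (A - ?O) (B - ?P)"
      using gbij by (rule bij_betw_cong[THEN iffD1, rotated]) (simp add: f_def)
    ultimately have "bij_betw f (?O \<union> (A - ?O)) (?P \<union> (B - ?P))"
      by (rule bij_betw_combine) auto
    then have fbij: "bij_betw f A B" using OA PB by (simp add: Un_absorb1)
    have fq: "f (p x) = q (f x)" if "x \<in> A" for x
      using that hq gq pin[of x] by (auto simp: f_def)
    have fout: "f x = undefined" if "x \<notin> A" for x
      using that gE OA by (auto simp: f_def PiE_def extensional_def)
    have "f \<in> A \<rightarrow>\<^sub>E B" using fbij fout by (auto simp: bij_betw_def)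
    moreover have "f a = b" using h[of 0] O by (auto simp: f_def permutation_self_in_orbit[OF p])
    ultimately have fF: "f \<in> ?F" using fbij fq by (simp add: intertwiners_def)
    have "g = ?r f"
      using gE by (auto simp: f_def PiE_def extensional_def fun_eq_iff)
    then show ?thesis using fF by (rule image_eqI)
  qed
  show ?thesis
    unfolding bij_betw_def using inj into onto by blast
qed

lemma finite_intertwiners:
  assumes "finite A" "finite B"
  shows "finite (intertwiners p A q B)"
  by (rule finite_subset[of _ "A \<rightarrow>\<^sub>E B"]) (use assms in \<open>auto simp: intertwiners_def intro: finite_PiE\<close>)

text \<open>
Induction over the removal of the orbit of a point \<open>a\<close>, of length \<open>l\<close>. The image of \<open>a\<close> can be any
of the \<open>l * c l\<close> points of \<open>B\<close> that lie in orbits of length \<open>l\<close>, and each choice leaves the same number of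
intertwiners by the induction hypothesis.
\<close>

theorem card_intertwiners:
  assumes p: "permutation p" and q: "permutation q" and "finite A" and "finite B"
    and "p ` A \<subseteq> A" and "q ` B \<subseteq> B" and "cycle_type p A = cycle_type q B"
  shows "card (intertwiners p A q B) = centralizer_order (cycle_type p A)"
  using assms(3-7)
proof (induction A arbitrary: B rule: finite_psubset_induct)
  case (psubset A)
  note pA = psubset.prems(2) and qB = psubset.prems(3) and eq = psubset.prems(4)
  show ?case
  proof (cases "A = {}")
    case True
    have "B = {}"
    proof (rule ccontr)
      assume "B \<noteq> {}"
      then obtain b where "b \<in> B" by auto
      then have "cycle_type q B (card (orbit q b)) > 0"
        using cycle_type_remove_orbit(1)[OF q \<open>finite B\<close>] by simp
      then show False using True eq[symmetric] by (simp add: cycle_type_def)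
    qed
    have "intertwiners p A q B = {\<lambda>x. undefined}"
      using True \<open>B = {}\<close> by (auto simp: intertwiners_def bij_betw_def)
    with True show ?thesis
      by (simp add: cycle_type_def centralizer_order_def)
  next
    case False
    then obtain a where a: "a \<in> A" by auto
    let ?O = "orbit p a"
    define l where "l = card ?O"
    let ?c = "cycle_type p A"
    let ?T = "{b \<in> B. card (orbit q b) = l}"
    have cl: "?c l > 0" and crem: "cycle_type p (A - ?O) = ?c(l := ?c l - 1)"
      using cycle_type_remove_orbit[OF p \<open>finite A\<close> a] by (simp_all add: l_def)
    have OA: "?O \<subseteq> A" using orbit_subset_invariant[OF pA a] .
    have psub: "A - ?O \<subset> A" using a permutation_self_in_orbit[OF p] by blast
    have part: "card {f \<in> intertwiners p A q B. f a = b} = centralizer_order (?c(l := ?c l - 1))"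
      if b: "b \<in> ?T" for b
    proof -
      have "card {f \<in> intertwiners p A q B. f a = b}
            = card (intertwiners p (A - ?O) q (B - orbit q b))"
        using b by (intro bij_betw_same_card[OF bij_betw_restrict_intertwiners[OF p q pA qB a]])
          (auto simp: l_def)
      also have "\<dots> = centralizer_order (cycle_type p (A - ?O))"
      proof (rule psubset.IH[OF psub])
        show "finite (B - orbit q b)" using \<open>finite B\<close> by simp
        show "p ` (A - ?O) \<subseteq> A - ?O" using pA apply_in_orbit_iff[OF p] by auto
        show "q ` (B - orbit q b) \<subseteq> B - orbit q b" using qB apply_in_orbit_iff[OF q] by auto
        show "cycle_type p (A - ?O) = cycle_type q (B - orbit q b)"
          using cycle_type_remove_orbit(2)[OF q \<open>finite B\<close>, of b] b crem eq by simp
      qed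
      finally show ?thesis by (simp add: crem)
    qed
    have img: "f a \<in> ?T" if f: "f \<in> intertwiners p A q B" for f
    proof -
      have f': "\<forall>x\<in>A. f (p x) = q (f x)" "bij_betw f A B" using f by (auto simp: intertwiners_def)
      have "card (f ` ?O) = card ?O"
        using f'(2) OA by (intro card_image) (meson bij_betw_def inj_on_subset)
      then show ?thesis
        using intertwiner_image_orbit[OF p q pA f'(1) a] a f'(2) by (auto simp: l_def bij_betw_def)
    qed
    have "intertwiners p A q B = (\<Union>b\<in>?T. {f \<in> intertwiners p A q B. f a = b})"
      using img by auto
    then have "card (intertwiners p A q B) = card (\<Union>b\<in>?T. {f \<in> intertwiners p A q B. f a = b})"
      by (rule arg_cong)
    also have "\<dots> = (\<Sum>b\<in>?T. card {f \<in> intertwiners p A q B. f a = b})"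
      by (rule card_UN_disjoint)
        (use \<open>finite B\<close> finite_intertwiners[OF \<open>finite A\<close> \<open>finite B\<close>] in auto)
    also have "\<dots> = card ?T * centralizer_order (?c(l := ?c l - 1))"
      using part by simp
    also have "card ?T = l * ?c l"
      using card_points_in_orbits[OF q \<open>finite B\<close> qB] eq by simp
    also have "l * ?c l * centralizer_order (?c(l := ?c l - 1)) = centralizer_order ?c"
    proof (rule centralizer_order_remove[symmetric])
      show "?c l > 0" by (rule cl)
      show "finite {l. ?c l \<noteq> 0}"
        by (rule finite_subset[of _ "{1..card A}"])
          (use cycle_type_range[OF p \<open>finite A\<close> pA] in auto)
    qed
    finally show ?thesis .
  qed
qed

section \<open>Permutations with a given cycle type\<close>

lemma cycle_of_list_orbit:
  assumes "distinct cs" "x \<in> set cs"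
  shows "orbit (cycle_of_list cs) x = set cs"
proof -
  let ?p = "cycle_of_list cs"
  have rot: "map (?p ^^ n) cs = rotate n cs" for n
    using cyclic_rotation[OF assms(1)] .
  have nth: "(?p ^^ n) (cs ! i) = cs ! ((i + n) mod length cs)" if "i < length cs" for i n
    using that arg_cong[OF rot[of n], of "\<lambda>xs. xs ! i"] by (simp add: nth_rotate add.commute)
  obtain i where i: "i < length cs" "x = cs ! i" using assms(2) by (auto simp: in_set_conv_nth)
  have "y \<in> orbit ?p x" if y: "y \<in> set cs" for y
  proof -
    obtain j where j: "j < length cs" "y = cs ! j" using y by (metis in_set_conv_nth)
    have "(?p ^^ (j + length cs - i)) x = y"
      using i j nth[OF i(1), of "j + length cs - i"] by simp
    then show ?thesis
      unfolding orbit_altdef_permutation[OF permutation_of_cycle] by auto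
  qed
  moreover have "orbit ?p x \<subseteq> set cs"
    using orbit_subset_invariant[of ?p "set cs" x] cycle_is_surj[OF assms(1)] assms(2) by simp
  ultimately show ?thesis by auto
qed

text \<open>Partitions of \<open>n\<close> into parts of size at most \<open>k\<close>, given by their multiplicity functions.\<close>

definition cycle_types :: "nat \<Rightarrow> nat \<Rightarrow> (nat \<Rightarrow> nat) set" where
  "cycle_types k n = {c. {l. c l \<noteq> 0} \<subseteq> {1..k} \<and> (\<Sum>l\<in>{1..k}. l * c l) = n}"

text \<open>
The count of the permutations of type \<open>c\<close> needs one of them to start from. It is built by adding one
cycle at a time.
\<close>

lemma exists_permutation_with_cycle_type:
  assumes "finite A" "c \<in> cycle_types k (card A)"
  shows "\<exists>p. p permutes A \<and> cycle_type p A = c"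
  using assms
proof (induction A arbitrary: c rule: finite_psubset_induct)
  case (psubset A)
  have supp: "{l. c l \<noteq> 0} \<subseteq> {1..k}" and size: "(\<Sum>l\<in>{1..k}. l * c l) = card A"
    using psubset.prems by (auto simp: cycle_types_def)
  show ?case
  proof (cases "A = {}")
    case True
    have "c l = 0" for l
      using size supp True by (cases "l \<in> {1..k}") auto
    then have "cycle_type id A = c" using True by (auto simp: cycle_type_def)
    then show ?thesis using permutes_id by blast
  next
    case False
    have "\<exists>l\<in>{1..k}. l * c l \<noteq> 0"
    proof (rule ccontr)
      assume "\<not> ?thesis"
      then have "(\<Sum>l\<in>{1..k}. l * c l) = 0" by (intro sum.neutral) auto
      then show False using size False \<open>finite A\<close> by simp
    qed
    then obtain l where l: "l \<in> {1..k}" "c l > 0" by auto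
    let ?c = "c(l := c l - 1)"
    have split: "(\<Sum>i\<in>{1..k}. i * c i) = l * c l + (\<Sum>i\<in>{1..k} - {l}. i * c i)"
      "(\<Sum>i\<in>{1..k}. i * ?c i) = l * (c l - 1) + (\<Sum>i\<in>{1..k} - {l}. i * c i)"
      using sum.remove[OF _ l(1), of "\<lambda>i. i * c i"] sum.remove[OF _ l(1), of "\<lambda>i. i * ?c i"] by auto
    have decr: "l * c l = l * (c l - 1) + l" using l(2) by (cases "c l") auto
    then have "l \<le> card A" using split(1) size by linarith
    then obtain S where S: "S \<subseteq> A" "card S = l"
      using \<open>finite A\<close> by (meson obtain_subset_with_card_n)
    have "finite S" using S \<open>finite A\<close> finite_subset by blast
    then obtain cs where cs: "set cs = S" "distinct cs" using finite_distinct_list by blast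
    have "S \<noteq> {}" using S l(1) by auto
    then obtain a where a: "a \<in> S" by auto
    have "card (A - S) = card A - l"
      using S card_Diff_subset[OF \<open>finite S\<close> S(1)] by simp
    then have "?c \<in> cycle_types k (card (A - S))"
    proof -
      have "{i. ?c i \<noteq> 0} \<subseteq> {1..k}" using supp l by (auto split: if_splits)
      moreover have "(\<Sum>i\<in>{1..k}. i * ?c i) = card A - l"
        using split size decr by linarith
      ultimately show ?thesis
        unfolding cycle_types_def \<open>card (A - S) = card A - l\<close> by blast
    qed
    moreover have "A - S \<subset> A" using a S by auto
    ultimately obtain q where q: "q permutes A - S" "cycle_type q (A - S) = ?c"
      using psubset.IH by blast
    define p where "p = cycle_of_list cs \<circ> q"
    have pS: "p x = cycle_of_list cs x" if "x \<in> S" for x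
      using that permutes_not_in[OF q(1), of x] by (simp add: p_def)
    have pA: "p x = q x" if "x \<in> A - S" for x
      using that permutes_in_image[OF q(1), of x] cs by (auto simp: p_def intro!: id_outside_supp)
    have "cycle_of_list cs permutes A"
      using cycle_permutes[of cs] permutes_subset cs S by blast
    moreover have "q permutes A" using q(1) permutes_subset by blast
    ultimately have perm: "p permutes A" unfolding p_def by (intro permutes_compose)
    then have perm': "permutation p" using \<open>finite A\<close> permutation_permutes by blast
    have qperm: "permutation q" using q(1) \<open>finite A\<close> permutation_permutes by blast
    have "orbit p a = orbit (cycle_of_list cs) a"
      by (rule orbit_cong0[where A = S])
        (use a pS cycle_is_surj[OF cs(2)] cs(1) in \<open>auto simp: image_subset_iff\<close>)
    then have orb: "orbit p a = S" using cycle_of_list_orbit[OF cs(2)] a cs by simp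
    have "orbit p x = orbit q x" if "x \<in> A - S" for x
      by (rule orbit_cong0[where A = "A - S"])
        (use that pA permutes_in_image[OF q(1)] in auto)
    then have "cycle_type p (A - S) = cycle_type q (A - S)"
      unfolding cycle_type_def by (simp cong: image_cong_simp)
    then have "cycle_type p (A - orbit p a) = ?c" using orb q by simp
    moreover have "a \<in> A" "p ` A \<subseteq> A" using a S permutes_image[OF perm] by auto
    ultimately have eqc: "?c = (cycle_type p A)(l := cycle_type p A l - 1)" and ctl: "cycle_type p A l > 0"
      using cycle_type_remove_orbit[OF perm' \<open>finite A\<close>, of a] orb S by auto
    have "cycle_type p A i = c i" for i
      using l(2) ctl fun_cong[OF eqc, of i] by (cases "i = l") auto
    then have "cycle_type p A = c" ..
    then show ?thesis using perm by blast
  qed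
qed

lemma cycle_type_in_cycle_types:
  assumes "p permutes A" "finite A"
  shows "cycle_type p A \<in> cycle_types (card A) (card A)"
proof -
  have "permutation p" "p ` A \<subseteq> A"
    using assms permutation_permutes permutes_image by blast+
  then show ?thesis
    using cycle_type_range[of p A] sum_cycle_type[of p A] assms(2)
    by (auto simp: cycle_types_def)
qed

definition conjugators :: "('a \<Rightarrow> 'a) \<Rightarrow> ('a \<Rightarrow> 'a) \<Rightarrow> 'a set \<Rightarrow> ('a \<Rightarrow> 'a) set" where
  "conjugators p q A = {f. f permutes A \<and> f \<circ> p = q \<circ> f}"

lemma card_conjugators:
  assumes "p permutes A" "q permutes A" "finite A"
  shows "card (conjugators p q A) = card (intertwiners p A q A)"
proof (rule bij_betw_same_card)
  show "bij_betw (\<lambda>f. restrict f A) (conjugators p q A) (intertwiners p A q A)"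
    unfolding bij_betw_def
  proof (intro conjI equalityI subsetI)
    show "inj_on (\<lambda>f. restrict f A) (conjugators p q A)"
    proof (rule inj_onI)
      fix f g assume f: "f \<in> conjugators p q A" and g: "g \<in> conjugators p q A"
        and eq: "restrict f A = restrict g A"
      have "f x = g x" for x
        using fun_cong[OF eq, of x] f g
        by (cases "x \<in> A") (auto simp: conjugators_def permutes_not_in)
      then show "f = g" ..
    qed
  next
    fix g assume "g \<in> (\<lambda>f. restrict f A) ` conjugators p q A"
    then obtain f where g: "g = restrict f A" and f: "f permutes A" "f \<circ> p = q \<circ> f"
      by (auto simp: conjugators_def)
    have "bij_betw g A A" using permutes_imp_bij[OF f(1)] by (simp add: g)
    moreover have "p x \<in> A" "f (p x) = q (f x)" if "x \<in> A" for x
      using that permutes_in_image[OF assms(1)] fun_cong[OF f(2), of x] by auto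
    ultimately show "g \<in> intertwiners p A q A"
      using permutes_in_image[OF f(1)] by (auto simp: intertwiners_def g)
  next
    fix g assume g: "g \<in> intertwiners p A q A"
    define f where "f x = (if x \<in> A then g x else x)" for x
    have "bij_betw f A A"
      using g by (auto simp: intertwiners_def f_def cong: bij_betw_cong)
    then have fperm: "f permutes A" by (rule bij_imp_permutes) (simp add: f_def)
    have "f (p x) = q (f x)" for x
      using g permutes_in_image[OF assms(1), of x] permutes_not_in[OF assms(1), of x]
        permutes_not_in[OF assms(2), of x]
      by (auto simp: intertwiners_def f_def)
    then have "f \<in> conjugators p q A" using fperm by (auto simp: conjugators_def)
    moreover have "restrict f A = g"
      using g by (auto simp: intertwiners_def f_def PiE_def extensional_def fun_eq_iff)
    ultimately show "g \<in> (\<lambda>f. restrict f A) ` conjugators p q A" by blast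
  qed
qed

text \<open>
For equal types the conjugators are counted by \<open>z(c)\<close>, which is positive. Conversely, a conjugator maps
the orbits of \<open>p\<close> onto those of \<open>q\<close> and preserves their sizes.
\<close>

lemma
  assumes p: "p permutes A" and q: "q permutes A" and "finite A"
  shows conjugators_nonempty_iff: "conjugators p q A \<noteq> {} \<longleftrightarrow> cycle_type p A = cycle_type q A"
    and card_conjugators_same_type:
      "cycle_type p A = cycle_type q A \<Longrightarrow> card (conjugators p q A) = centralizer_order (cycle_type p A)"
proof -
  have perm: "permutation p" "permutation q" and im: "p ` A \<subseteq> A" "q ` A \<subseteq> A"
    using assms permutation_permutes permutes_image by blast+
  show *: "card (conjugators p q A) = centralizer_order (cycle_type p A)"
    if "cycle_type p A = cycle_type q A"
    using card_conjugators[OF assms] card_intertwiners[OF perm \<open>finite A\<close> \<open>finite A\<close> im that] by simp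
  show "conjugators p q A \<noteq> {} \<longleftrightarrow> cycle_type p A = cycle_type q A"
  proof
    assume eq: "cycle_type p A = cycle_type q A"
    have "centralizer_order (cycle_type p A) > 0"
      using cycle_type_range[OF perm(1) \<open>finite A\<close> im(1)] by (intro centralizer_order_pos) fastforce
    then show "conjugators p q A \<noteq> {}" using *[OF eq] by auto
  next
    assume "conjugators p q A \<noteq> {}"
    then obtain f where f: "f permutes A" and fpq: "f \<circ> p = q \<circ> f"
      by (auto simp: conjugators_def)
    have orb: "f ` orbit p x = orbit q (f x)" if "x \<in> A" for x
      using fpq that by (intro intertwiner_image_orbit[OF perm im(1)]) (auto simp: fun_eq_iff)
    have inj: "inj f" using f by (rule permutes_inj)
    have fA: "f ` A = A" using f by (rule permutes_image)
    have orbits: "orbit q ` A = (`) f ` orbit p ` A"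
    proof -
      have "orbit q ` A = orbit q ` f ` A" using fA by simp
      also have "\<dots> = (\<lambda>x. f ` orbit p x) ` A"
        unfolding image_image using orb by (intro image_cong) auto
      finally show ?thesis by (simp add: image_image)
    qed
    show "cycle_type p A = cycle_type q A"
    proof
      fix l
      have "{S \<in> orbit q ` A. card S = l} = (`) f ` {S \<in> orbit p ` A. card S = l}"
        unfolding orbits using card_image[OF inj_on_subset[OF inj subset_UNIV]] by auto
      then have "cycle_type q A l = card ((`) f ` {S \<in> orbit p ` A. card S = l})"
        by (simp only: cycle_type_def)
      also have "\<dots> = cycle_type p A l"
        unfolding cycle_type_def using inj by (intro card_image inj_onI) (simp add: inj_image_eq_iff)
      finally show "cycle_type p A l = cycle_type q A l" ..
    qed
  qed
qed

text \<open>
Fix one permutation \<open>p\<close> of type \<open>c\<close>. Each of the \<open>n!\<close> permutations \<open>f\<close> conjugates \<open>p\<close> to exactly one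
permutation \<open>q\<close> of type \<open>c\<close>, and each \<open>q\<close> is reached from \<open>z(c)\<close> many \<open>f\<close>.
\<close>

lemma card_permutations_with_cycle_type:
  assumes "finite A" "c \<in> cycle_types k (card A)"
  shows "card {p. p permutes A \<and> cycle_type p A = c} * centralizer_order c = fact (card A)"
proof -
  obtain p where p: "p permutes A" "cycle_type p A = c"
    using exists_permutation_with_cycle_type[OF assms] by blast
  let ?Q = "{q. q permutes A \<and> cycle_type q A = c}"
  have fin: "finite {q. q permutes A}" using \<open>finite A\<close> by (rule finite_permutations)
  have cover: "{f. f permutes A} = (\<Union>q\<in>?Q. conjugators p q A)"
  proof (intro equalityI subsetI)
    fix f assume "f \<in> {f. f permutes A}"
    then have f: "f permutes A" by simp
    define q where "q = f \<circ> p \<circ> inv' f"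
    have q: "q permutes A"
      unfolding q_def using f p permutes_inv permutes_compose by metis
    have fq: "f \<in> conjugators p q A"
      using f permutes_inv_o(2)[OF f] by (simp add: conjugators_def q_def comp_assoc)
    then have "q \<in> ?Q" using q conjugators_nonempty_iff[OF p(1) q \<open>finite A\<close>] p(2) by auto
    then show "f \<in> (\<Union>q\<in>?Q. conjugators p q A)" using fq by blast
  qed (auto simp: conjugators_def)
  have "fact (card A) = card (\<Union>q\<in>?Q. conjugators p q A)"
    unfolding cover[symmetric] card_permutations[OF refl \<open>finite A\<close>] ..
  also have "\<dots> = (\<Sum>q\<in>?Q. card (conjugators p q A))"
  proof (rule card_UN_disjoint)
    show "finite ?Q" using fin by simp
    show "\<forall>q\<in>?Q. finite (conjugators p q A)"
      using fin by (auto simp: conjugators_def)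
    have "q = r" if f: "f \<in> conjugators p q A" "f \<in> conjugators p r A" for f q r
    proof
      fix x
      have "surj f" using f(1) permutes_surj by (auto simp: conjugators_def)
      then obtain y where "x = f y" by (rule surjE)
      moreover have "q (f y) = f (p y)" "r (f y) = f (p y)"
        using f by (auto simp: conjugators_def fun_eq_iff)
      ultimately show "q x = r x" by simp
    qed
    then show "\<forall>q\<in>?Q. \<forall>r\<in>?Q. q \<noteq> r \<longrightarrow> conjugators p q A \<inter> conjugators p r A = {}"
      by blast
  qed
  also have "\<dots> = (\<Sum>q\<in>?Q. centralizer_order c)"
    using card_conjugators_same_type[OF p(1) _ \<open>finite A\<close>] p(2) by (intro sum.cong) auto
  finally show ?thesis by simp
qed

section \<open>The conjugacy probability as a sum over cycle types\<close>

lemma finite_cycle_types: "finite (cycle_types k n)"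
proof (rule finite_subset)
  show "finite {c. \<forall>l. (l \<in> {1..k} \<longrightarrow> c l \<in> {0..n}) \<and> (l \<notin> {1..k} \<longrightarrow> c l = (0::nat))}"
    by (rule finite_set_of_finite_funs) auto
  have "c l \<le> n" if c: "c \<in> cycle_types k n" and l: "l \<in> {1..k}" for c l
  proof -
    have "c l \<le> l * c l" using l by simp
    also have "\<dots> \<le> (\<Sum>l\<in>{1..k}. l * c l)" using l by (intro member_le_sum) auto
    finally show ?thesis using c by (simp add: cycle_types_def)
  qed
  then show "cycle_types k n \<subseteq> {c. \<forall>l. (l \<in> {1..k} \<longrightarrow> c l \<in> {0..n}) \<and> (l \<notin> {1..k} \<longrightarrow> c l = 0)}"
    unfolding cycle_types_def by fastforce
qed

lemma cycle_types_support:
  assumes "c \<in> cycle_types k n" "c l \<noteq> 0"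
  shows "l \<in> {1..k}" "l \<le> n"
proof -
  show l: "l \<in> {1..k}" using assms by (auto simp: cycle_types_def)
  have "l \<le> l * c l" using assms(2) by simp
  also have "\<dots> \<le> (\<Sum>l\<in>{1..k}. l * c l)" using l by (intro member_le_sum) auto
  finally show "l \<le> n" using assms(1) by (simp add: cycle_types_def)
qed

lemma finite_support_cycle_types:
  assumes "c \<in> cycle_types k n"
  shows "finite {l. c l \<noteq> 0}"
  by (rule finite_subset[of _ "{1..k}"]) (use assms in \<open>auto simp: cycle_types_def\<close>)

lemma centralizer_order_cycle_types_pos:
  assumes "c \<in> cycle_types k n"
  shows "centralizer_order c > 0"
  using cycle_types_support(1)[OF assms] by (intro centralizer_order_pos) fastforce

definition kappa_parts :: "nat \<Rightarrow> nat \<Rightarrow> real" where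
  "kappa_parts k n = (\<Sum>c\<in>cycle_types k n. 1 / (real (centralizer_order c))\<^sup>2)"

lemma conjugate_in_sym_group_iff:
  "conjugate_in (sym_group n) p q \<longleftrightarrow>
     p permutes {1..n} \<and> q permutes {1..n} \<and> cycle_type p {1..n} = cycle_type q {1..n}"
proof -
  have "(\<exists>x\<in>carrier (sym_group n). q = x \<otimes>\<^bsub>sym_group n\<^esub> p \<otimes>\<^bsub>sym_group n\<^esub> inv\<^bsub>sym_group n\<^esub> x)
        \<longleftrightarrow> conjugators p q {1..n} \<noteq> {}"
  proof -
    have "q = f \<circ> p \<circ> inv' f \<longleftrightarrow> f \<circ> p = q \<circ> f" if "f permutes {1..n}" for f
    proof
      assume "q = f \<circ> p \<circ> inv' f"
      then show "f \<circ> p = q \<circ> f"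
        by (simp add: comp_assoc permutes_inv_o(2)[OF that])
    next
      assume "f \<circ> p = q \<circ> f"
      then show "q = f \<circ> p \<circ> inv' f"
        by (simp add: comp_assoc permutes_inv_o(1)[OF that])
    qed
    then show ?thesis
      by (auto simp: conjugators_def sym_group_carrier sym_group_mult)
  qed
  then show ?thesis
    using conjugators_nonempty_iff[of p "{1..n}" q]
    by (auto simp: conjugate_in_def sym_group_carrier)
qed

lemma pair_pmf_of_set:
  assumes "finite A" "A \<noteq> {}" "finite B" "B \<noteq> {}"
  shows "pair_pmf (pmf_of_set A) (pmf_of_set B) = pmf_of_set (A \<times> B)"
proof (rule pmf_eqI)
  fix x :: "'a \<times> 'b"
  show "pmf (pair_pmf (pmf_of_set A) (pmf_of_set B)) x = pmf (pmf_of_set (A \<times> B)) x"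
    using assms by (cases x) (simp add: pmf_pair pmf_of_set indicator_def card_cartesian_product)
qed

text \<open>
The conjugate pairs are the disjoint union, over the types \<open>c\<close>, of the squares of the conjugacy classes, and
the class of type \<open>c\<close> has \<open>n! / z(c)\<close> elements.
\<close>

theorem kappa_sym_group: "kappa (sym_group n) = kappa_parts n n"
proof -
  let ?P = "{p. p permutes {1..n}}" and ?T = "cycle_types n n"
  let ?Q = "\<lambda>c. {p. p permutes {1..n} \<and> cycle_type p {1..n} = c}"
  have fin: "finite ?P" by (rule finite_permutations) simp
  have ne: "?P \<noteq> {}" using permutes_id by blast
  have card: "card ?P = fact n" by (rule card_permutations) auto
  have carrier: "carrier (sym_group n) = ?P" by (simp add: sym_group_def)
  have finQ: "finite (?Q c)" for c using fin by simp
  have "(?P \<times> ?P) \<inter> {(g, h). conjugate_in (sym_group n) g h} = (\<Union>c\<in>?T. ?Q c \<times> ?Q c)"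
    using cycle_type_in_cycle_types[of _ "{1..n}"] by (auto simp: conjugate_in_sym_group_iff)
  moreover have "card (\<Union>c\<in>?T. ?Q c \<times> ?Q c) = (\<Sum>c\<in>?T. card (?Q c \<times> ?Q c))"
    by (rule card_UN_disjoint) (use finite_cycle_types finQ in auto)
  ultimately have "kappa (sym_group n) = (\<Sum>c\<in>?T. card (?Q c \<times> ?Q c)) / card (?P \<times> ?P)"
    unfolding kappa_def carrier using fin ne
    by (simp add: pair_pmf_of_set measure_pmf_of_set)
  also have "\<dots> = (\<Sum>c\<in>?T. real (card (?Q c) * card (?Q c)) / (fact n * fact n))"
    by (simp add: card_cartesian_product card[simplified] sum_divide_distrib)
  also have "\<dots> = kappa_parts n n"
    unfolding kappa_parts_def
  proof (rule sum.cong[OF refl])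
    fix c assume c: "c \<in> ?T"
    have "card (?Q c) * centralizer_order c = fact n"
      using card_permutations_with_cycle_type[of "{1..n}" c n] c by simp
    then have "real (card (?Q c)) * real (centralizer_order c) = fact n"
      by (metis of_nat_fact of_nat_mult)
    moreover have "real (centralizer_order c) > 0"
      using centralizer_order_cycle_types_pos[OF c] by simp
    ultimately have "real (card (?Q c)) / fact n = 1 / real (centralizer_order c)"
      by (simp add: field_simps)
    then have "(real (card (?Q c)) / fact n) * (real (card (?Q c)) / fact n)
        = (1 / real (centralizer_order c)) * (1 / real (centralizer_order c))" by simp
    then show "real (card (?Q c) * card (?Q c)) / (fact n * fact n) = 1 / (real (centralizer_order c))\<^sup>2"
      by (simp add: power2_eq_square)
  qed
  finally show ?thesis .
qed

section \<open>Inequalities from removing a cycle\<close>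

lemma cycle_types_eq:
  assumes "n \<le> k"
  shows "cycle_types k n = cycle_types n n"
proof (intro equalityI subsetI)
  fix c assume c: "c \<in> cycle_types k n"
  have supp: "{l. c l \<noteq> 0} \<subseteq> {1..n}" using cycle_types_support[OF c] by auto
  have "(\<Sum>l\<in>{1..n}. l * c l) = (\<Sum>l\<in>{1..k}. l * c l)"
    by (rule sum.mono_neutral_left) (use assms supp in auto)
  then show "c \<in> cycle_types n n" using c supp by (simp add: cycle_types_def)
next
  fix c assume c: "c \<in> cycle_types n n"
  have "(\<Sum>l\<in>{1..n}. l * c l) = (\<Sum>l\<in>{1..k}. l * c l)"
    by (rule sum.mono_neutral_left) (use assms c in \<open>auto simp: cycle_types_def\<close>)
  then show "c \<in> cycle_types k n" using c assms by (auto simp: cycle_types_def)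
qed

lemma cycle_types_mono:
  assumes "k \<le> k'"
  shows "cycle_types k n \<subseteq> cycle_types k' n"
proof
  fix c assume c: "c \<in> cycle_types k n"
  have "(\<Sum>l\<in>{1..k}. l * c l) = (\<Sum>l\<in>{1..k'}. l * c l)"
    by (rule sum.mono_neutral_left) (use assms c in \<open>auto simp: cycle_types_def\<close>)
  then show "c \<in> cycle_types k' n" using c assms by (auto simp: cycle_types_def)
qed

lemma kappa_parts_nonneg: "kappa_parts k n \<ge> 0"
  unfolding kappa_parts_def by (intro sum_nonneg) simp

lemma kappa_parts_eq: "n \<le> k \<Longrightarrow> kappa_parts k n = kappa_parts n n"
  unfolding kappa_parts_def by (simp only: cycle_types_eq[of n k])

lemma kappa_parts_mono: "k \<le> k' \<Longrightarrow> kappa_parts k n \<le> kappa_parts k' n"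
  unfolding kappa_parts_def
  by (intro sum_mono2 finite_cycle_types cycle_types_mono) auto

lemma kappa_parts_le: "kappa_parts k n \<le> kappa_parts n n"
  using kappa_parts_eq[of n k] kappa_parts_mono[of k n n] by (cases "n \<le> k") auto

lemma sum_cycle_types_remove_part:
  assumes l: "l \<in> {1..k}"
  shows "(\<Sum>c | c \<in> cycle_types k n \<and> c l > 0. g (c(l := c l - 1)))
         = (if l \<le> n then \<Sum>c\<in>cycle_types k (n - l). g c else (0::real))"
proof (cases "l \<le> n")
  case False
  then have "{c. c \<in> cycle_types k n \<and> c l > 0} = {}"
    using cycle_types_support(2)[of _ k n l] by auto
  then show ?thesis using False by (simp only: sum.empty if_False)
next
  case True
  have split: "(\<Sum>i\<in>{1..k}. i * (c :: nat \<Rightarrow> nat) i) = l * c l + (\<Sum>i\<in>{1..k} - {l}. i * c i)" for c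
    by (rule sum.remove[OF finite_atLeastAtMost l])
  have upd: "(\<Sum>i\<in>{1..k}. i * (c(l := m)) i) = l * m + (\<Sum>i\<in>{1..k} - {l}. i * c i)"
    for c :: "nat \<Rightarrow> nat" and m
  proof -
    have "(\<Sum>i\<in>{1..k} - {l}. i * (c(l := m)) i) = (\<Sum>i\<in>{1..k} - {l}. i * c i)"
      by (intro sum.cong) auto
    then show ?thesis using split[of "c(l := m)"] by (simp only: fun_upd_same)
  qed
  have "(\<Sum>c | c \<in> cycle_types k n \<and> c l > 0. g (c(l := c l - 1))) = (\<Sum>c\<in>cycle_types k (n - l). g c)"
  proof (rule sum.reindex_bij_witness[where i = "\<lambda>c. c(l := c l + 1)" and j = "\<lambda>c. c(l := c l - 1)"])
    fix c assume "c \<in> {c. c \<in> cycle_types k n \<and> c l > 0}"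
    then have c: "c \<in> cycle_types k n" and cl: "c l > 0" by auto
    show "(c(l := c l - 1))(l := (c(l := c l - 1)) l + 1) = c" using cl by auto
    have "l * c l = l * (c l - 1) + l" using cl by (cases "c l") auto
    then have "(\<Sum>i\<in>{1..k}. i * (c(l := c l - 1)) i) = n - l"
      using c split[of c] upd[of c "c l - 1"] by (simp add: cycle_types_def)
    moreover have "{i. (c(l := c l - 1)) i \<noteq> 0} \<subseteq> {1..k}"
      using c cl by (auto simp: cycle_types_def split: if_splits)
    ultimately show "c(l := c l - 1) \<in> cycle_types k (n - l)"
      unfolding cycle_types_def by blast
  next
    fix c assume c: "c \<in> cycle_types k (n - l)"
    show "(c(l := c l + 1))(l := (c(l := c l + 1)) l - 1) = c" by auto
    have "(\<Sum>i\<in>{1..k}. i * (c(l := c l + 1)) i) = n"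
      using c split[of c] upd[of c "c l + 1"] True by (simp add: cycle_types_def)
    moreover have "{i. (c(l := c l + 1)) i \<noteq> 0} \<subseteq> {1..k}"
      using c l by (auto simp: cycle_types_def split: if_splits)
    ultimately show "c(l := c l + 1) \<in> {c. c \<in> cycle_types k n \<and> c l > 0}"
      unfolding cycle_types_def by simp
  qed auto
  then show ?thesis using True by simp
qed

lemma inverse_centralizer_order_remove:
  assumes "c \<in> cycle_types k n" "c l > 0"
  shows "1 / (real (centralizer_order c))\<^sup>2
         = (1 / (real l * real (c l))\<^sup>2) * (1 / (real (centralizer_order (c(l := c l - 1))))\<^sup>2)"
  using centralizer_order_remove[OF finite_support_cycle_types[OF assms(1)] assms(2)]
  by (simp add: power_mult_distrib)

text \<open>
Replace the factor \<open>n\<close> by \<open>(\<Sum>l. l * c l)\<close> in every summand. Removing a cycle of length \<open>l\<close> from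
\<open>c\<close> turns \<open>l * c l / z(c)\<^sup>2\<close> into \<open>1 / (l * c l)\<close> times the summand of the smaller type. The bound forgets
the factor \<open>1 / c l\<close>.
\<close>

lemma kappa_parts_le_average:
  "real n * kappa_parts k n \<le> (\<Sum>l=1..min k n. kappa_parts k (n - l) / real l)"
proof -
  have fin: "finite (cycle_types k n)" by (rule finite_cycle_types)
  let ?z = "\<lambda>c. 1 / (real (centralizer_order c))\<^sup>2"
  have "real n * kappa_parts k n = (\<Sum>c\<in>cycle_types k n. (\<Sum>l=1..k. real l * real (c l) * ?z c))"
    unfolding kappa_parts_def sum_distrib_left
  proof (rule sum.cong[OF refl])
    fix c assume "c \<in> cycle_types k n"
    then have "real n = real (\<Sum>l=1..k. l * c l)" by (simp add: cycle_types_def)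
    then show "real n * ?z c = (\<Sum>l=1..k. real l * real (c l) * ?z c)"
      by (simp add: sum_divide_distrib)
  qed
  also have "\<dots> = (\<Sum>l=1..k. \<Sum>c\<in>cycle_types k n. real l * real (c l) * ?z c)"
    by (rule sum.swap)
  also have "\<dots> \<le> (\<Sum>l=1..k. (if l \<le> n then \<Sum>c\<in>cycle_types k (n - l). ?z c / real l else 0))"
  proof (rule sum_mono)
    fix l assume l: "l \<in> {1..k}"
    have "(\<Sum>c\<in>cycle_types k n. real l * real (c l) * ?z c)
          = (\<Sum>c | c \<in> cycle_types k n \<and> c l > 0. real l * real (c l) * ?z c)"
      by (rule sum.mono_neutral_right) (use fin in auto)
    also have "\<dots> \<le> (\<Sum>c | c \<in> cycle_types k n \<and> c l > 0. ?z (c(l := c l - 1)) / real l)"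
    proof (rule sum_mono)
      fix c assume "c \<in> {c. c \<in> cycle_types k n \<and> c l > 0}"
      then have c: "c \<in> cycle_types k n" "c l > 0" by auto
      have "real l * real (c l) * ?z c = 1 / (real l * real (c l)) * ?z (c(l := c l - 1))"
        unfolding inverse_centralizer_order_remove[OF c] using c l
        by (simp add: power2_eq_square field_simps)
      also have "\<dots> \<le> 1 / real l * ?z (c(l := c l - 1))"
        using c l by (intro mult_right_mono divide_left_mono) auto
      finally show "real l * real (c l) * ?z c \<le> ?z (c(l := c l - 1)) / real l"
        by (simp add: mult.commute)
    qed
    also have "\<dots> = (if l \<le> n then \<Sum>c\<in>cycle_types k (n - l). ?z c / real l else 0)"
      by (rule sum_cycle_types_remove_part[OF l])
    finally show "(\<Sum>c\<in>cycle_types k n. real l * real (c l) * ?z c)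
       \<le> (if l \<le> n then \<Sum>c\<in>cycle_types k (n - l). ?z c / real l else 0)" .
  qed
  also have "\<dots> = (\<Sum>l=1..k. (if l \<le> n then kappa_parts k (n - l) / real l else 0))"
    unfolding kappa_parts_def sum_divide_distrib by simp
  also have "\<dots> = (\<Sum>l=1..min k n. kappa_parts k (n - l) / real l)"
    by (rule sum.mono_neutral_cong_right) auto
  finally show ?thesis .
qed

text \<open>
A type outside \<open>cycle_types k n\<close> has a cycle of some length \<open>l > k\<close>; removing one such cycle
costs a factor \<open>1 / (l * c l)\<^sup>2 \<le> 1 / l\<^sup>2\<close>. Types with several long cycles are counted more than once.
\<close>

lemma kappa_parts_le_long_part:
  "kappa_parts n n \<le> kappa_parts k n + (\<Sum>l=Suc k..n. kappa_parts (n - l) (n - l) / (real l)\<^sup>2)"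
proof -
  let ?z = "\<lambda>c. 1 / (real (centralizer_order c))\<^sup>2"
  let ?T = "cycle_types n n"
  let ?w = "\<lambda>c l. if c l > 0 then ?z (c(l := c l - 1)) / (real l)\<^sup>2 else 0"
  have fin: "finite ?T" by (rule finite_cycle_types)
  have sub: "{c \<in> ?T. \<forall>l. c l \<noteq> 0 \<longrightarrow> l \<le> k} \<subseteq> cycle_types k n"
  proof
    fix c assume "c \<in> {c \<in> ?T. \<forall>l. c l \<noteq> 0 \<longrightarrow> l \<le> k}"
    then have c: "c \<in> ?T" and le: "\<And>l. c l \<noteq> 0 \<Longrightarrow> l \<le> k" by auto
    have "(\<Sum>l\<in>{1..n}. l * c l) = (\<Sum>l\<in>{1..k}. l * c l)"
      by (rule sum.mono_neutral_cong) (use c le in \<open>auto simp: cycle_types_def\<close>)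
    then show "c \<in> cycle_types k n" using c le by (auto simp: cycle_types_def)
  qed
  have "kappa_parts n n \<le> (\<Sum>c\<in>?T. (if \<forall>l. c l \<noteq> 0 \<longrightarrow> l \<le> k then ?z c else 0) + (\<Sum>l=Suc k..n. ?w c l))"
    unfolding kappa_parts_def
  proof (rule sum_mono)
    fix c assume c: "c \<in> ?T"
    show "?z c \<le> (if \<forall>l. c l \<noteq> 0 \<longrightarrow> l \<le> k then ?z c else 0) + (\<Sum>l=Suc k..n. ?w c l)"
    proof (cases "\<forall>l. c l \<noteq> 0 \<longrightarrow> l \<le> k")
      case True
      have "(\<Sum>l=Suc k..n. ?w c l) \<ge> 0" by (intro sum_nonneg) simp
      then show ?thesis using True by simp
    next
      case False
      then obtain l where l: "c l > 0" "l > k" by auto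
      then have ln: "l \<in> {Suc k..n}" "l \<ge> 1" using cycle_types_support[OF c, of l] by auto
      have "1 / (real l * real (c l))\<^sup>2 \<le> 1 / (real l)\<^sup>2"
        using l ln by (intro divide_left_mono power_mono) auto
      then have "?z c \<le> 1 / (real l)\<^sup>2 * ?z (c(l := c l - 1))"
        unfolding inverse_centralizer_order_remove[OF c l(1)]
        by (rule mult_right_mono) simp
      also have "\<dots> = ?w c l" using l by simp
      also have "\<dots> \<le> (\<Sum>l=Suc k..n. ?w c l)"
        by (rule member_le_sum[OF ln(1)]) auto
      finally show ?thesis using False by auto
    qed
  qed
  also have "\<dots> = (\<Sum>c | c \<in> ?T \<and> (\<forall>l. c l \<noteq> 0 \<longrightarrow> l \<le> k). ?z c)
      + (\<Sum>l=Suc k..n. \<Sum>c\<in>?T. ?w c l)"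
  proof -
    have "(\<Sum>c\<in>?T. if \<forall>l. c l \<noteq> 0 \<longrightarrow> l \<le> k then ?z c else 0)
        = (\<Sum>c | c \<in> ?T \<and> (\<forall>l. c l \<noteq> 0 \<longrightarrow> l \<le> k). ?z c)"
      by (rule sum.inter_filter[OF fin, symmetric])
    moreover have "(\<Sum>c\<in>?T. \<Sum>l=Suc k..n. ?w c l) = (\<Sum>l=Suc k..n. \<Sum>c\<in>?T. ?w c l)"
      by (rule sum.swap)
    ultimately show ?thesis by (simp only: sum.distrib)
  qed
  also have "\<dots> \<le> kappa_parts k n + (\<Sum>l=Suc k..n. kappa_parts (n - l) (n - l) / (real l)\<^sup>2)"
  proof (rule add_mono)
    show "(\<Sum>c | c \<in> ?T \<and> (\<forall>l. c l \<noteq> 0 \<longrightarrow> l \<le> k). ?z c) \<le> kappa_parts k n"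
      unfolding kappa_parts_def using sub by (intro sum_mono2 finite_cycle_types) auto
    show "(\<Sum>l=Suc k..n. \<Sum>c\<in>?T. ?w c l) \<le> (\<Sum>l=Suc k..n. kappa_parts (n - l) (n - l) / (real l)\<^sup>2)"
    proof (rule sum_mono)
      fix l assume l: "l \<in> {Suc k..n}"
      have "(\<Sum>c\<in>?T. ?w c l) = (\<Sum>c | c \<in> ?T \<and> c l > 0. ?z (c(l := c l - 1)) / (real l)\<^sup>2)"
        by (rule sum.inter_filter[OF fin, symmetric])
      also have "\<dots> = (\<Sum>c\<in>cycle_types n (n - l). ?z c / (real l)\<^sup>2)"
        using sum_cycle_types_remove_part[of l n "\<lambda>c. ?z c / (real l)\<^sup>2" n] l by simp
      also have "\<dots> = kappa_parts n (n - l) / (real l)\<^sup>2"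
        by (simp add: kappa_parts_def sum_divide_distrib)
      finally show "(\<Sum>c\<in>?T. ?w c l) \<le> kappa_parts (n - l) (n - l) / (real l)\<^sup>2"
        using kappa_parts_eq[of "n - l" n] by simp
    qed
  qed
  finally show ?thesis .
qed

section \<open>Tabulating the first values\<close>

lemma kappa_parts_0: "kappa_parts 0 n = (if n = 0 then 1 else 0)"
proof -
  have "cycle_types 0 n = (if n = 0 then {\<lambda>_. 0} else {})"
    by (auto simp: cycle_types_def)
  then show ?thesis by (simp add: kappa_parts_def centralizer_order_def)
qed

text \<open>Types are sorted by the number \<open>i\<close> of cycles of the largest length \<open>k + 1\<close>.\<close>

lemma kappa_parts_Suc:
  "kappa_parts (Suc k) n =
     (\<Sum>i\<le>n div Suc k. kappa_parts k (n - i * Suc k) / (real (Suc k) ^ i * fact i)\<^sup>2)"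
proof -
  let ?z = "\<lambda>c. 1 / (real (centralizer_order c))\<^sup>2"
  let ?A = "\<lambda>i. {c \<in> cycle_types (Suc k) n. c (Suc k) = i}"
  have le: "c (Suc k) \<le> n div Suc k" if "c \<in> cycle_types (Suc k) n" for c
  proof -
    have "Suc k * c (Suc k) \<le> (\<Sum>l\<in>{1..Suc k}. l * c l)" by (rule member_le_sum) auto
    then show ?thesis using that
      by (simp add: cycle_types_def less_eq_div_iff_mult_less_eq mult.commute del: mult_Suc mult_Suc_right)
  qed
  have "kappa_parts (Suc k) n = (\<Sum>c\<in>(\<Union>i\<le>n div Suc k. ?A i). ?z c)"
    unfolding kappa_parts_def using le by (intro sum.cong) auto
  also have "\<dots> = (\<Sum>i\<le>n div Suc k. \<Sum>c\<in>?A i. ?z c)"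
    by (rule sum.UNION_disjoint) (use finite_cycle_types in auto)
  also have "\<dots> = (\<Sum>i\<le>n div Suc k. kappa_parts k (n - i * Suc k) / (real (Suc k) ^ i * fact i)\<^sup>2)"
  proof (rule sum.cong[OF refl])
    fix i assume "i \<in> {..n div Suc k}"
    then have i: "i * Suc k \<le> n"
      by (metis atMost_iff less_eq_div_iff_mult_less_eq zero_less_Suc)
    have zero: "c (Suc k) = 0" if "c \<in> cycle_types k m" for c m
      using cycle_types_support(1)[OF that, of "Suc k"] by auto
    have "(\<Sum>c\<in>?A i. ?z c)
        = (\<Sum>c\<in>cycle_types k (n - i * Suc k). ?z c / (real (Suc k) ^ i * fact i)\<^sup>2)"
    proof (rule sum.reindex_bij_witness[where i = "\<lambda>c. c(Suc k := i)" and j = "\<lambda>c. c(Suc k := 0)"])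
      fix c assume "c \<in> ?A i"
      then have c: "c \<in> cycle_types (Suc k) n" and ci: "c (Suc k) = i" by auto
      show "c(Suc k := 0, Suc k := i) = c" using ci by auto
      have "(\<Sum>l\<in>{1..k}. l * (c(Suc k := 0)) l) = (\<Sum>l\<in>{1..k}. l * c l)"
        by (intro sum.cong) auto
      then show mem: "c(Suc k := 0) \<in> cycle_types k (n - i * Suc k)"
        using c ci by (auto simp: cycle_types_def atLeastAtMostSuc_conv le_Suc_eq mult.commute)
      have "centralizer_order c = (\<Prod>l\<in>{1..Suc k}. l ^ c l * fact (c l))"
        using c by (intro centralizer_order_superset) (auto simp: cycle_types_def)
      also have "\<dots> = (\<Prod>l\<in>{1..k}. l ^ c l * fact (c l)) * (Suc k ^ i * fact i)"
        by (simp add: ci atLeastAtMostSuc_conv mult.commute del: power_Suc)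
      also have "(\<Prod>l\<in>{1..k}. l ^ c l * fact (c l))
          = (\<Prod>l\<in>{1..k}. l ^ (c(Suc k := 0)) l * fact ((c(Suc k := 0)) l))"
        by (intro prod.cong) auto
      also have "\<dots> = centralizer_order (c(Suc k := 0))"
        using mem by (intro centralizer_order_superset[symmetric]) (auto simp: cycle_types_def)
      finally show "?z (c(Suc k := 0)) / (real (Suc k) ^ i * fact i)\<^sup>2 = ?z c"
        by (simp add: power_mult_distrib)
    next
      fix c assume c: "c \<in> cycle_types k (n - i * Suc k)"
      show "c(Suc k := i, Suc k := 0) = c" using zero[OF c] by auto
      have "(\<Sum>l\<in>{1..k}. l * (c(Suc k := i)) l) = (\<Sum>l\<in>{1..k}. l * c l)"
        by (intro sum.cong) auto
      then have "(\<Sum>l\<in>{1..Suc k}. l * (c(Suc k := i)) l) = Suc k * i + (n - i * Suc k)"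
        using c by (simp add: cycle_types_def)
      then have "(\<Sum>l\<in>{1..Suc k}. l * (c(Suc k := i)) l) = n"
        using i by (simp add: mult.commute)
      moreover have "{l. (c(Suc k := i)) l \<noteq> 0} \<subseteq> {1..Suc k}"
        using c by (auto simp: cycle_types_def)
      ultimately show "c(Suc k := i) \<in> ?A i" by (simp add: cycle_types_def)
    qed
    also have "\<dots> = kappa_parts k (n - i * Suc k) / (real (Suc k) ^ i * fact i)\<^sup>2"
      by (simp add: kappa_parts_def sum_divide_distrib)
    finally show "(\<Sum>c\<in>?A i. ?z c) = kappa_parts k (n - i * Suc k) / (real (Suc k) ^ i * fact i)\<^sup>2" .
  qed
  finally show ?thesis .
qed

text \<open>
The intermediate values of Horner's scheme for the sum in \<open>kappa_parts_Suc\<close>. Its weights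
\<open>1 / ((k+1) ^ i * i!)\<^sup>2\<close> are products of the factors \<open>1 / ((k+1) * j)\<^sup>2\<close> for \<open>j \<le> i\<close>; here the first \<open>m\<close>
factors have been pulled out. The scheme only ever divides by the small numbers \<open>((k+1) * j)\<^sup>2\<close>,
which makes it suitable for rounded integer arithmetic.
\<close>

definition kappa_tail :: "nat \<Rightarrow> nat \<Rightarrow> nat \<Rightarrow> real" where
  "kappa_tail k m n = (\<Sum>i\<le>n div Suc k.
     kappa_parts k (n - i * Suc k) * (fact m / (real (Suc k) ^ i * fact (m + i)))\<^sup>2)"

lemma kappa_tail_0: "kappa_tail k 0 n = kappa_parts (Suc k) n"
  unfolding kappa_tail_def kappa_parts_Suc by (simp add: power_divide)

lemma kappa_tail_less: "n < Suc k \<Longrightarrow> kappa_tail k m n = kappa_parts k n"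
  by (simp add: kappa_tail_def del: mult_Suc_right)

lemma kappa_tail_step:
  assumes "Suc k \<le> n"
  shows "kappa_tail k m n = kappa_parts k n
           + kappa_tail k (Suc m) (n - Suc k) / (real (Suc k) * real (Suc m))\<^sup>2"
proof -
  have div: "n div Suc k = Suc ((n - Suc k) div Suc k)"
    using assms by (simp add: le_div_geq)
  have "kappa_tail k m n = kappa_parts k n + (\<Sum>i\<le>(n - Suc k) div Suc k.
     kappa_parts k (n - Suc i * Suc k) * (fact m / (real (Suc k) ^ Suc i * fact (m + Suc i)))\<^sup>2)"
    unfolding kappa_tail_def div by (subst sum.atMost_Suc_shift) simp
  also have "(\<Sum>i\<le>(n - Suc k) div Suc k.
     kappa_parts k (n - Suc i * Suc k) * (fact m / (real (Suc k) ^ Suc i * fact (m + Suc i)))\<^sup>2)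
     = kappa_tail k (Suc m) (n - Suc k) / (real (Suc k) * real (Suc m))\<^sup>2"
    unfolding kappa_tail_def sum_divide_distrib
  proof (rule sum.cong[OF refl])
    fix i
    have eq: "(fact m :: real) / (real (Suc k) ^ Suc i * fact (m + Suc i))
        = fact (Suc m) / (real (Suc k) ^ i * fact (Suc m + i)) / (real (Suc k) * real (Suc m))"
      by (simp add: divide_simps del: of_nat_Suc)
    have sub: "n - Suc i * Suc k = n - Suc k - i * Suc k" by simp
    show "kappa_parts k (n - Suc i * Suc k) * (fact m / (real (Suc k) ^ Suc i * fact (m + Suc i)))\<^sup>2
      = kappa_parts k (n - Suc k - i * Suc k) * (fact (Suc m) / (real (Suc k) ^ i * fact (Suc m + i)))\<^sup>2
          / (real (Suc k) * real (Suc m))\<^sup>2"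
      by (simp only: sub eq power_divide times_divide_eq_right)
  qed
  finally show ?thesis .
qed

text \<open>
Horner's scheme on a whole row: if \<open>xs\<close> holds \<open>K (k-1) n\<close> for \<open>n < length xs\<close>, up to a common scaling
factor, then the result for \<open>m = 1\<close> holds \<open>K k n\<close>, where each division is rounded down and then
corrected by \<open>r\<close>. The choice \<open>r = 1\<close> yields upper bounds and \<open>r = 0\<close> lower bounds.
\<close>

function horner_row :: "int \<Rightarrow> nat \<Rightarrow> int \<Rightarrow> int list \<Rightarrow> int list" where
  "horner_row r k m xs =
     (if k = 0 \<or> length xs \<le> k then xs
      else take k xs @ map2 (\<lambda>x y. x + y div (int k * m)\<^sup>2 + r) (drop k xs)
             (horner_row r k (m + 1) (take (length xs - k) xs)))"
  by pat_completeness auto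
termination by (relation "Wellfounded.measure (\<lambda>(r, k, m, xs). length xs)") auto

declare horner_row.simps [simp del]

lemma length_horner_row [simp]: "length (horner_row r k m xs) = length xs"
  by (induction r k m xs rule: horner_row.induct) (subst horner_row.simps, auto)

lemma horner_row_nth_less:
  assumes "n < k" "n < length xs"
  shows "horner_row r k m xs ! n = xs ! n"
  by (subst horner_row.simps) (use assms in \<open>auto simp: nth_append\<close>)

lemma horner_row_nth_ge:
  assumes "0 < k" "k \<le> n" "n < length xs"
  shows "horner_row r k m xs ! n = xs ! n
     + horner_row r k (m + 1) (take (length xs - k) xs) ! (n - k) div (int k * m)\<^sup>2 + r"
  by (subst horner_row.simps) (use assms in \<open>auto simp: nth_append\<close>)

lemma horner_row_upper:
  assumes "\<And>n. n < length xs \<Longrightarrow> D * kappa_parts k n \<le> real_of_int (xs ! n)" and "n < length xs"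
  shows "D * kappa_tail k m n \<le> real_of_int (horner_row 1 (Suc k) (int (Suc m)) xs ! n)"
  using assms
proof (induction n arbitrary: m xs rule: less_induct)
  case (less n)
  show ?case
  proof (cases "n < Suc k")
    case True
    then show ?thesis
      using less.prems by (simp add: kappa_tail_less horner_row_nth_less)
  next
    case False
    let ?d = "(int (Suc k) * int (Suc m))\<^sup>2"
    define y where "y = horner_row 1 (Suc k) (int (Suc (Suc m))) (take (length xs - Suc k) xs) ! (n - Suc k)"
    have "D * kappa_tail k (Suc m) (n - Suc k) \<le> real_of_int y"
      unfolding y_def using False less.prems by (intro less.IH) auto
    then have "D * (kappa_tail k (Suc m) (n - Suc k) / real_of_int ?d) \<le> real_of_int y / real_of_int ?d"
      by (simp add: divide_right_mono)
    also have "\<dots> \<le> real_of_int (y div ?d + 1)"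
      using real_of_int_div4[of y ?d] floor_divide_of_int_eq[of y ?d, where ?'a = real] by linarith
    finally have tail: "D * (kappa_tail k (Suc m) (n - Suc k) / real_of_int ?d) \<le> real_of_int (y div ?d + 1)" .
    have nth: "horner_row 1 (Suc k) (int (Suc m)) xs ! n = xs ! n + y div ?d + 1"
      using horner_row_nth_ge[of "Suc k" n xs 1 "int (Suc m)"] False less.prems
      by (simp add: y_def add.commute)
    have "D * kappa_tail k m n = D * kappa_parts k n + D * (kappa_tail k (Suc m) (n - Suc k) / real_of_int ?d)"
      using kappa_tail_step[of k n m] False by (simp add: distrib_left)
    also have "\<dots> \<le> real_of_int (xs ! n) + real_of_int (y div ?d + 1)"
      using less.prems tail by (intro add_mono) auto
    finally show ?thesis unfolding nth by simp
  qed
qed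

lemma horner_row_lower:
  assumes "\<And>n. n < length xs \<Longrightarrow> real_of_int (xs ! n) \<le> D * kappa_parts k n" and "n < length xs"
  shows "real_of_int (horner_row 0 (Suc k) (int (Suc m)) xs ! n) \<le> D * kappa_tail k m n"
  using assms
proof (induction n arbitrary: m xs rule: less_induct)
  case (less n)
  show ?case
  proof (cases "n < Suc k")
    case True
    then show ?thesis
      using less.prems by (simp add: kappa_tail_less horner_row_nth_less)
  next
    case False
    let ?d = "(int (Suc k) * int (Suc m))\<^sup>2"
    define y where "y = horner_row 0 (Suc k) (int (Suc (Suc m))) (take (length xs - Suc k) xs) ! (n - Suc k)"
    have "real_of_int (y div ?d) \<le> real_of_int y / real_of_int ?d"
      by (rule real_of_int_div4)
    also have "real_of_int y \<le> D * kappa_tail k (Suc m) (n - Suc k)"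
      unfolding y_def using False less.prems by (intro less.IH) auto
    then have "real_of_int y / real_of_int ?d \<le> D * (kappa_tail k (Suc m) (n - Suc k) / real_of_int ?d)"
      by (simp add: divide_right_mono)
    finally have tail: "real_of_int (y div ?d) \<le> D * (kappa_tail k (Suc m) (n - Suc k) / real_of_int ?d)" .
    have nth: "horner_row 0 (Suc k) (int (Suc m)) xs ! n = xs ! n + y div ?d"
      using horner_row_nth_ge[of "Suc k" n xs 0 "int (Suc m)"] False less.prems
      by (simp add: y_def add.commute)
    have "real_of_int (xs ! n) + real_of_int (y div ?d)
        \<le> D * kappa_parts k n + D * (kappa_tail k (Suc m) (n - Suc k) / real_of_int ?d)"
      using less.prems tail by (intro add_mono) auto
    also have "\<dots> = D * kappa_tail k m n"
      using kappa_tail_step[of k n m] False by (simp add: distrib_left)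
    finally show ?thesis unfolding nth by simp
  qed
qed

primrec kappa_rows :: "int \<Rightarrow> int list \<Rightarrow> nat \<Rightarrow> int list" where
  "kappa_rows r xs 0 = xs"
| "kappa_rows r xs (Suc k) = horner_row r (Suc k) 1 (kappa_rows r xs k)"

lemma length_kappa_rows [simp]: "length (kappa_rows r xs k) = length xs"
  by (induction k) simp_all

text \<open>The row for \<open>k = 0\<close>: the only type without cycles is that of the empty permutation.\<close>

lemma nth_unit_row: "n \<le> N \<Longrightarrow> real_of_int ((D # replicate N 0) ! n) = real_of_int D * kappa_parts 0 n"
  by (cases n) (simp_all add: kappa_parts_0)

lemma kappa_rows_upper:
  "n \<le> N \<Longrightarrow> real_of_int D * kappa_parts k n \<le> real_of_int (kappa_rows 1 (D # replicate N 0) k ! n)"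
proof (induction k arbitrary: n)
  case 0
  then show ?case by (simp add: nth_unit_row)
next
  case (Suc k)
  show ?case
    using horner_row_upper[of "kappa_rows 1 (D # replicate N 0) k" "real_of_int D" k n 0] Suc
    by (simp add: kappa_tail_0 less_Suc_eq_le)
qed

lemma kappa_rows_lower:
  "n \<le> N \<Longrightarrow> real_of_int (kappa_rows 0 (D # replicate N 0) k ! n) \<le> real_of_int D * kappa_parts k n"
proof (induction k arbitrary: n)
  case 0
  then show ?case by (simp add: nth_unit_row)
next
  case (Suc k)
  show ?case
    using horner_row_lower[of "kappa_rows 0 (D # replicate N 0) k" "real_of_int D" k n 0] Suc
    by (simp add: kappa_tail_0 less_Suc_eq_le)
qed

text \<open>
Upper bounds for \<open>10\<^sup>9 K n n\<close> for \<open>n \<le> 55\<close>. A row for \<open>k = 55\<close> serves all these \<open>n\<close>, as cycles longer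
than \<open>n\<close> do not occur. The accumulated rounding error is a few dozen units at most, well below
the margin that the comparison with \<open>C\<close> leaves.
\<close>

lemma kappa_table_upper:
  "kappa_rows 1 (10 ^ 9 # replicate 55 0) 55 =
     [
      1000000000, 1000000001, 500000003, 388888893, 253472227, 180694450, 137754636,
      105336835, 82591481, 66425912, 54457600, 45192664, 38075717, 32447076, 27925175,
      24279903, 21266757, 18772253, 16677589, 14910864, 13396820, 12104063, 10980234,
      10006423, 9151142, 8401769, 7736171, 7148078, 6621076, 6151202, 5727303, 5346550,
      5000561, 4687979, 4402251, 4142512, 3903954, 3685972, 3484767, 3300129, 3128976,
      2971216, 2824471, 2688688, 2561922, 2444251, 2334041, 2231395, 2135002, 2044961,
      1960173, 1880767, 1805810, 1735427, 1668848, 1606190]"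
  by code_simp

lemma kappa_table_lower:
  "kappa_rows 0 (10 ^ 9 # replicate 13 0) 13 =
     [
      1000000000, 1000000000, 500000000, 388888888, 253472222, 180694443, 137754628,
      105336826, 82591470, 66425899, 54457585, 45192650, 38075704, 32447058]"
  by code_simp

section \<open>The induction\<close>

lemma kappa_parts_table:
  assumes "n \<le> 55"
  shows "10 ^ 9 * kappa_parts n n \<le> real_of_int (kappa_rows 1 (10 ^ 9 # replicate 55 0) 55 ! n)"
  using kappa_rows_upper[of n 55 "10 ^ 9" 55] kappa_parts_eq[of n 55] assms by simp

lemma C_kappa_eq: "C_kappa = 169 * kappa_parts 13 13"
  by (simp add: C_kappa_def kappa_sym_group)

lemma C_kappa_lower: "C_kappa \<ge> 169 * 32447058 / 10 ^ 9"
  using kappa_rows_lower[of 13 13 "10 ^ 9" 13] unfolding kappa_table_lower C_kappa_eq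
  by simp

lemma kappa_parts_le_small:
  assumes "1 \<le> n" "n \<le> 55"
  shows "kappa_parts n n \<le> C_kappa / (real n)\<^sup>2"
proof (cases "n = 13")
  case True
  then show ?thesis by (simp add: C_kappa_eq)
next
  case False
  have check: "list_all (\<lambda>n. n = 13 \<or> (int n)\<^sup>2 * (kappa_rows 1 (10 ^ 9 # replicate 55 0) 55 ! n)
      \<le> 169 * 32447058) [1..<56]"
    unfolding kappa_table_upper by code_simp
  have "(int n)\<^sup>2 * (kappa_rows 1 (10 ^ 9 # replicate 55 0) 55 ! n) \<le> 169 * 32447058"
    using check assms False by (auto simp: list_all_iff)
  then have "real_of_int ((int n)\<^sup>2 * (kappa_rows 1 (10 ^ 9 # replicate 55 0) 55 ! n)) \<le> 169 * 32447058"
    by linarith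
  then have "(real n)\<^sup>2 * real_of_int (kappa_rows 1 (10 ^ 9 # replicate 55 0) 55 ! n) \<le> 169 * 32447058"
    by simp
  moreover have "(real n)\<^sup>2 * (10 ^ 9 * kappa_parts n n)
      \<le> (real n)\<^sup>2 * real_of_int (kappa_rows 1 (10 ^ 9 # replicate 55 0) 55 ! n)"
    using assms by (intro mult_left_mono kappa_parts_table) auto
  ultimately have "(real n)\<^sup>2 * kappa_parts n n \<le> 169 * 32447058 / 10 ^ 9" by simp
  then have "(real n)\<^sup>2 * kappa_parts n n \<le> C_kappa" using C_kappa_lower by simp
  then show ?thesis using assms by (simp add: field_simps)
qed

text \<open>This reduces the estimates for large \<open>n\<close> to a numerical check at a single value \<open>N\<close>.\<close>

lemma div_sub_square_antimono:
  fixes n N l :: real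
  assumes "N \<le> n" "0 \<le> l" "l < N"
  shows "n / (n - l)\<^sup>2 \<le> N / (N - l)\<^sup>2"
proof -
  have "l\<^sup>2 \<le> n * N" using assms by (auto simp: power2_eq_square intro!: mult_mono)
  then have "(n - N) * (l\<^sup>2 - n * N) \<le> 0"
    using assms by (intro mult_nonneg_nonpos) auto
  then have "n * (N - l)\<^sup>2 \<le> N * (n - l)\<^sup>2"
    by (simp add: power2_eq_square algebra_simps)
  then show ?thesis using assms by (simp add: divide_simps mult.commute)
qed

text \<open>
The averaging inequality as an amplifier: if \<open>K k\<close> is at most \<open>B / m\<^sup>2\<close> at the \<open>k\<close> preceding arguments
\<open>m\<close>, then the same holds at \<open>n\<close> with \<open>B\<close> multiplied by a constant that is small once \<open>n\<close> is large
compared with \<open>k\<close>.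
\<close>

lemma kappa_parts_average_bound:
  assumes "\<And>l. l \<in> {1..k} \<Longrightarrow> kappa_parts k (n - l) \<le> B / (real (n - l))\<^sup>2"
    and "k < N" "N \<le> n" "B \<ge> 0"
  shows "kappa_parts k n \<le> B * (\<Sum>l=1..k. real N / (real l * (real (N - l))\<^sup>2)) / (real n)\<^sup>2"
proof -
  have "real n * (real n * kappa_parts k n) \<le> real n * (\<Sum>l=1..min k n. kappa_parts k (n - l) / real l)"
    by (intro mult_left_mono kappa_parts_le_average) simp
  also have "min k n = k" using assms by simp
  also have "real n * (\<Sum>l=1..k. kappa_parts k (n - l) / real l)
      \<le> B * (\<Sum>l=1..k. real N / (real l * (real (N - l))\<^sup>2))"
    unfolding sum_distrib_left
  proof (rule sum_mono)
    fix l assume l: "l \<in> {1..k}"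
    have "real n * (kappa_parts k (n - l) / real l) \<le> real n * (B / (real (n - l))\<^sup>2 / real l)"
      using assms(1)[OF l] by (intro mult_left_mono divide_right_mono) auto
    also have "\<dots> = B / real l * (real n / (real n - real l)\<^sup>2)"
      using l assms(2,3) by (simp add: of_nat_diff ac_simps)
    also have "\<dots> \<le> B / real l * (real N / (real N - real l)\<^sup>2)"
      using l assms by (intro mult_left_mono div_sub_square_antimono) auto
    finally show "real n * (kappa_parts k (n - l) / real l) \<le> B * (real N / (real l * (real (N - l))\<^sup>2))"
      using l assms by (simp add: of_nat_diff)
  qed
  finally have "(real n)\<^sup>2 * kappa_parts k n \<le> B * (\<Sum>l=1..k. real N / (real l * (real (N - l))\<^sup>2))"
    by (simp add: power2_eq_square mult.assoc)
  then show ?thesis using assms by (simp add: field_simps)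
qed

text \<open>Telescoping, because \<open>1 / l\<^sup>2 \<le> 1 / (l - 1/2) - 1 / (l + 1/2)\<close>.\<close>

lemma sum_inverse_squares_le:
  assumes "1 \<le> a"
  shows "(\<Sum>l=a..b. 1 / (real l)\<^sup>2) \<le> 1 / (real a - 1 / 2)"
proof -
  have telescope: "(\<Sum>l=a..<a + d. 1 / (real l)\<^sup>2) \<le> 1 / (real a - 1 / 2) - 1 / (real (a + d) - 1 / 2)" for d
  proof (induction d)
    case (Suc d)
    define x where "x = real (a + d)"
    have x: "x \<ge> 1" using assms by (simp add: x_def)
    have "1 / x\<^sup>2 \<le> 1 / ((x - 1 / 2) * (x + 1 / 2))"
      using x by (intro divide_left_mono mult_pos_pos) (auto simp: power2_eq_square algebra_simps)
    also have "\<dots> = 1 / (x - 1 / 2) - 1 / (x + 1 / 2)"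
      using x by (simp add: divide_simps)
    also have "x + 1 / 2 = real (a + Suc d) - 1 / 2" by (simp add: x_def)
    finally have "1 / x\<^sup>2 \<le> 1 / (x - 1 / 2) - 1 / (real (a + Suc d) - 1 / 2)" .
    moreover have "(\<Sum>l=a..<a + Suc d. 1 / (real l)\<^sup>2) = (\<Sum>l=a..<a + d. 1 / (real l)\<^sup>2) + 1 / x\<^sup>2"
      by (simp add: x_def)
    ultimately show ?case using Suc unfolding x_def by linarith
  qed simp
  have bound: "(\<Sum>l=a..<a + d. 1 / (real l)\<^sup>2) \<le> 1 / (real a - 1 / 2)" for d
  proof -
    have "0 \<le> 1 / (real (a + d) - 1 / 2)" using assms by simp
    with telescope[of d] show ?thesis by linarith
  qed
  show ?thesis
  proof (cases "a \<le> b")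
    case True
    then have "{a..b} = {a..<a + (Suc b - a)}" by auto
    then show ?thesis using bound by (simp only:)
  next
    case False
    then show ?thesis using assms by simp
  qed
qed

text \<open>
The left side grows by at most \<open>1/35 + 1/51 < 0.0482\<close> when \<open>n\<close> increases by one, so only the
value at \<open>n = 56\<close> has to be computed.
\<close>

lemma harmonic_pair_bound:
  assumes "56 \<le> n"
  shows "(\<Sum>l=6..n - 22. 1 / real l) + (\<Sum>l=22..n - 6. 1 / real l) \<le> 482 / 10000 * real n"
  using assms
proof (induction n rule: nat_induct_at_least)
  case base
  show ?case by (simp add: sum.atLeastAtMost_shift_0 atMost_nat_numeral atMost_Suc flip: atMost_atLeast0)
next
  case (Suc n)
  have eq: "Suc n - 22 = Suc (n - 22)" "Suc n - 6 = Suc (n - 6)" using Suc by auto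
  define u v where "u = 1 / real (Suc (n - 22))" and "v = 1 / real (Suc (n - 6))"
  have "u \<le> 1 / 35" "v \<le> 1 / 51"
    unfolding u_def v_def using Suc.hyps by (intro divide_left_mono; simp)+
  moreover have "6 \<le> Suc (n - 22)" "22 \<le> Suc (n - 6)" using Suc by auto
  then have "(\<Sum>l=6..Suc (n - 22). 1 / real l) = u + (\<Sum>l=6..n - 22. 1 / real l)"
    "(\<Sum>l=22..Suc (n - 6). 1 / real l) = v + (\<Sum>l=22..n - 6. 1 / real l)"
    unfolding u_def v_def by (simp_all only: sum.nat_ivl_Suc' le_SucI)
  ultimately have "(\<Sum>l=6..Suc (n - 22). 1 / real l) + (\<Sum>l=22..Suc (n - 6). 1 / real l)
      \<le> (1 / 35 + (\<Sum>l=6..n - 22. 1 / real l)) + (1 / 51 + (\<Sum>l=22..n - 6. 1 / real l))"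
    by (simp only: add_mono order_refl)
  also have "\<dots> \<le> 482 / 10000 * real n + (1 / 35 + 1 / 51)"
    using Suc.IH by (simp only: add.assoc add.left_commute add_le_cancel_left)
  also have "\<dots> \<le> 482 / 10000 * real (Suc n)"
    by simp
  finally show ?case unfolding eq .
qed

lemma rho_35: "(\<Sum>l=1..21. real 35 / (real l * (real (35 - l))\<^sup>2)) \<le> 177 / 1000"
  by (simp add: sum.atLeast1_atMost_eq lessThan_nat_numeral lessThan_Suc)

lemma rho_56: "(\<Sum>l=1..21. real 56 / (real l * (real (56 - l))\<^sup>2)) \<le> 846 / 10000"
  by (simp add: sum.atLeast1_atMost_eq lessThan_nat_numeral lessThan_Suc)

text \<open>
The cut-offs \<open>21\<close> for short cycles and \<open>5\<close> for small remainders \<open>n - l\<close> balance the three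
contributions: larger cut-offs shrink the middle sum but enlarge the other two.
\<close>

lemma kappa_parts_le_large:
  assumes n: "56 \<le> n" and IH: "\<And>m. 1 \<le> m \<Longrightarrow> m < n \<Longrightarrow> kappa_parts m m \<le> C_kappa / (real m)\<^sup>2"
  shows "kappa_parts n n \<le> C_kappa / (real n)\<^sup>2"
proof -
  let ?C = "C_kappa" and ?n = "real n"
  have C: "?C \<ge> 54835 / 10000" using C_kappa_lower by simp
  have C0: "?C \<ge> 0" using C by simp

  \<comment> \<open>Types with short cycles only. The averaging bound is applied once at each
     \<open>m \<in> {n - 21..n - 1}\<close>, where \<open>m \<ge> 35\<close>, and then once more at \<open>n\<close>.\<close>
  have short: "?n\<^sup>2 * kappa_parts 21 n \<le> ?C * (15 / 1000)"
  proof -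
    have once: "kappa_parts 21 m \<le> ?C * (177 / 1000) / (real m)\<^sup>2" if m: "35 \<le> m" "m < n" for m
    proof -
      have "kappa_parts 21 m \<le> ?C * (\<Sum>l=1..21. real 35 / (real l * (real (35 - l))\<^sup>2)) / (real m)\<^sup>2"
      proof (rule kappa_parts_average_bound[OF _ _ m(1) C0])
        fix l :: nat assume l: "l \<in> {1..21}"
        have "kappa_parts 21 (m - l) \<le> kappa_parts (m - l) (m - l)" by (rule kappa_parts_le)
        also have "\<dots> \<le> ?C / (real (m - l))\<^sup>2" using l m by (intro IH) auto
        finally show "kappa_parts 21 (m - l) \<le> ?C / (real (m - l))\<^sup>2" .
      qed simp
      also have "\<dots> \<le> ?C * (177 / 1000) / (real m)\<^sup>2"
        using C0 by (intro divide_right_mono mult_left_mono rho_35) auto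
      finally show ?thesis .
    qed
    have "kappa_parts 21 n \<le> ?C * (177 / 1000)
        * (\<Sum>l=1..21. real 56 / (real l * (real (56 - l))\<^sup>2)) / ?n\<^sup>2"
    proof (rule kappa_parts_average_bound[OF _ _ n])
      fix l :: nat assume "l \<in> {1..21}"
      then show "kappa_parts 21 (n - l) \<le> ?C * (177 / 1000) / (real (n - l))\<^sup>2"
        using n by (intro once) auto
    qed (use C0 in auto)
    also have "\<dots> \<le> ?C * (177 / 1000) * (846 / 10000) / ?n\<^sup>2"
      using C0 by (intro divide_right_mono mult_left_mono rho_56) auto
    finally have "?n\<^sup>2 * kappa_parts 21 n \<le> ?C * (177 / 1000) * (846 / 10000)"
      using n by (simp add: field_simps)
    also have "\<dots> \<le> ?C * (15 / 1000)" using C0 by simp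
    finally show ?thesis .
  qed

  \<comment> \<open>One cycle covers all but at most five points; the factor \<open>n / (n - m)\<close> is largest at \<open>n = 56\<close>.\<close>
  have small: "(\<Sum>l=n-5..n. ?n\<^sup>2 * (kappa_parts (n - l) (n - l) / (real l)\<^sup>2)) \<le> 35205 / 10000"
  proof -
    have "(\<Sum>l=n-5..n. ?n\<^sup>2 * (kappa_parts (n - l) (n - l) / (real l)\<^sup>2))
        = (\<Sum>m=0..5. ?n\<^sup>2 * (kappa_parts m m / (real (n - m))\<^sup>2))"
      by (rule sum.reindex_bij_witness[where i = "\<lambda>m. n - m" and j = "\<lambda>l. n - l"]) (use n in auto)
    also have "\<dots> \<le> (\<Sum>m=0..5. (real 56 / real (56 - m))\<^sup>2
        * (real_of_int (kappa_rows 1 (10 ^ 9 # replicate 55 0) 55 ! m) / 10 ^ 9))"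
    proof (rule sum_mono)
      fix m :: nat assume "m \<in> {0..5}"
      then have m: "m \<le> 5" by simp
      have "?n / real (n - m) \<le> real 56 / real (56 - m)"
      proof -
        have "?n * (56 - real m) \<le> 56 * (?n - real m)"
          using n m mult_right_mono[of 56 ?n "real m"] by (simp add: algebra_simps)
        then show ?thesis
          using n m by (simp add: of_nat_diff pos_divide_le_eq pos_le_divide_eq)
      qed
      then have "(?n / real (n - m))\<^sup>2 \<le> (real 56 / real (56 - m))\<^sup>2"
        by (intro power_mono) auto
      moreover have "kappa_parts m m \<le> real_of_int (kappa_rows 1 (10 ^ 9 # replicate 55 0) 55 ! m) / 10 ^ 9"
        using kappa_parts_table[of m] m by simp
      ultimately have "(?n / real (n - m))\<^sup>2 * kappa_parts m m \<le> (real 56 / real (56 - m))\<^sup>2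
        * (real_of_int (kappa_rows 1 (10 ^ 9 # replicate 55 0) 55 ! m) / 10 ^ 9)"
        by (intro mult_mono kappa_parts_nonneg) auto
      then show "?n\<^sup>2 * (kappa_parts m m / (real (n - m))\<^sup>2) \<le> (real 56 / real (56 - m))\<^sup>2
        * (real_of_int (kappa_rows 1 (10 ^ 9 # replicate 55 0) 55 ! m) / 10 ^ 9)"
        by (simp add: power_divide)
    qed
    also have "\<dots> \<le> 35205 / 10000"
      unfolding kappa_table_upper
      by (simp add: atLeast0AtMost atMost_nat_numeral atMost_Suc power2_eq_square)
    finally show ?thesis .
  qed

  \<comment> \<open>With \<open>m = n - l\<close>, the identity \<open>n / (m * l) = 1 / m + 1 / l\<close> splits the summand
     \<open>C * n\<^sup>2 / (m * l)\<^sup>2\<close> into two inverse squares and a mixed term, and the mixed terms reduce to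
     harmonic sums by the same identity.\<close>
  have middle: "(\<Sum>l=22..n-6. ?n\<^sup>2 * (kappa_parts (n - l) (n - l) / (real l)\<^sup>2))
      \<le> ?C * (2 / 11 + 2 / 43 + 964 / 10000)"
  proof -
    have sq: "(\<Sum>l=22..n-6. 1 / (real l)\<^sup>2) \<le> 2 / 43"
      using sum_inverse_squares_le[of 22 "n - 6"] by simp
    have reflect: "(\<Sum>l=22..n-6. f (n - l)) = (\<Sum>m=6..n-22. f m)" for f :: "nat \<Rightarrow> real"
      by (rule sum.reindex_bij_witness[where i = "\<lambda>m. n - m" and j = "\<lambda>l. n - l"]) (use n in auto)
    have sq': "(\<Sum>l=22..n-6. 1 / (real (n - l))\<^sup>2) \<le> 2 / 11"
      using sum_inverse_squares_le[of 6 "n - 22"] reflect[of "\<lambda>m. 1 / (real m)\<^sup>2"] by simp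
    have "?n * (\<Sum>l=22..n-6. 1 / (real l * real (n - l)))
        = (\<Sum>l=22..n-6. 1 / real (n - l) + 1 / real l)"
      unfolding sum_distrib_left
      by (rule sum.cong[OF refl]) (use n in \<open>auto simp: of_nat_diff divide_simps\<close>)
    also have "\<dots> \<le> 482 / 10000 * ?n"
      using harmonic_pair_bound[OF n] reflect[of "\<lambda>m. 1 / real m"] by (simp add: sum.distrib)
    finally have mixed: "(\<Sum>l=22..n-6. 1 / (real l * real (n - l))) \<le> 482 / 10000"
      using n by simp
    have "(\<Sum>l=22..n-6. ?n\<^sup>2 * (kappa_parts (n - l) (n - l) / (real l)\<^sup>2))
        \<le> (\<Sum>l=22..n-6. ?C * (1 / (real (n - l))\<^sup>2 + 1 / (real l)\<^sup>2 + 2 * (1 / (real l * real (n - l)))))"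
    proof (rule sum_mono)
      fix l assume "l \<in> {22..n-6}"
      then have l: "22 \<le> l" "l + 6 \<le> n" using n by auto
      define x y where "x = real l" and "y = real (n - l)"
      have xy: "x > 0" "y > 0" "?n = x + y" using l by (auto simp: x_def y_def of_nat_diff)
      have "kappa_parts (n - l) (n - l) \<le> ?C / y\<^sup>2"
        unfolding y_def using l by (intro IH) auto
      then have "?n\<^sup>2 * (kappa_parts (n - l) (n - l) / x\<^sup>2) \<le> (x + y)\<^sup>2 * (?C / y\<^sup>2 / x\<^sup>2)"
        unfolding xy(3) by (intro mult_left_mono divide_right_mono) auto
      also have "\<dots> = ?C * (1 / y\<^sup>2 + 1 / x\<^sup>2 + 2 * (1 / (x * y)))"
        using xy by (simp add: divide_simps) (simp add: power2_eq_square algebra_simps)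
      finally show "?n\<^sup>2 * (kappa_parts (n - l) (n - l) / (real l)\<^sup>2)
          \<le> ?C * (1 / (real (n - l))\<^sup>2 + 1 / (real l)\<^sup>2 + 2 * (1 / (real l * real (n - l))))"
        by (simp add: x_def y_def)
    qed
    also have "\<dots> = ?C * ((\<Sum>l=22..n-6. 1 / (real (n - l))\<^sup>2) + (\<Sum>l=22..n-6. 1 / (real l)\<^sup>2)
        + 2 * (\<Sum>l=22..n-6. 1 / (real l * real (n - l))))"
      by (simp only: sum_distrib_left[symmetric] sum.distrib)
    also have "\<dots> \<le> ?C * (2 / 11 + 2 / 43 + 2 * (482 / 10000))"
      by (rule mult_left_mono[OF add_mono[OF add_mono[OF sq' sq] mult_left_mono[OF mixed]] C0]) simp
    also have "\<dots> = ?C * (2 / 11 + 2 / 43 + 964 / 10000)" by simp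
    finally show ?thesis .
  qed

  have "{Suc 21..n} = {22..n-6} \<union> {n-5..n}" using n by auto
  moreover have "{22..n-6} \<inter> {n-5..n} = {}" by auto
  ultimately have "?n\<^sup>2 * (\<Sum>l=Suc 21..n. kappa_parts (n - l) (n - l) / (real l)\<^sup>2)
      = (\<Sum>l=22..n-6. ?n\<^sup>2 * (kappa_parts (n - l) (n - l) / (real l)\<^sup>2))
        + (\<Sum>l=n-5..n. ?n\<^sup>2 * (kappa_parts (n - l) (n - l) / (real l)\<^sup>2))"
    by (simp only: sum.union_disjoint finite_atLeastAtMost distrib_left sum_distrib_left)
  then have long: "?n\<^sup>2 * (\<Sum>l=Suc 21..n. kappa_parts (n - l) (n - l) / (real l)\<^sup>2)
      \<le> ?C * (2 / 11 + 2 / 43 + 964 / 10000) + 35205 / 10000"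
    using add_mono[OF middle small] by (simp only:)
  have "?n\<^sup>2 * kappa_parts n n \<le> ?n\<^sup>2 * kappa_parts 21 n
      + ?n\<^sup>2 * (\<Sum>l=Suc 21..n. kappa_parts (n - l) (n - l) / (real l)\<^sup>2)"
    using mult_left_mono[OF kappa_parts_le_long_part[of n 21], of "?n\<^sup>2"]
    by (simp only: distrib_left zero_le_power2)
  also have "\<dots> \<le> ?C * (15 / 1000) + (?C * (2 / 11 + 2 / 43 + 964 / 10000) + 35205 / 10000)"
    using short long by (rule add_mono)
  also have "\<dots> \<le> ?C" using C by simp
  finally have "?n\<^sup>2 * kappa_parts n n \<le> ?C" .
  moreover have "?n\<^sup>2 > 0" using n by simp
  ultimately show ?thesis by (simp only: pos_le_divide_eq mult.commute)
qed

theorem kappa_parts_bound: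
  "1 \<le> n \<Longrightarrow> kappa_parts n n \<le> C_kappa / (real n)\<^sup>2"
proof (induction n rule: less_induct)
  case (less n)
  show ?case
  proof (cases "n \<le> 55")
    case True
    with less.prems show ?thesis by (rule kappa_parts_le_small)
  next
    case False
    then have "56 \<le> n" by simp
    then show ?thesis using less.IH by (rule kappa_parts_le_large)
  qed
qed

theorem theorem1p4:
  fixes n :: nat
  assumes "n > 0"
  shows "kappa (sym_group n) \<le> C_kappa / (real n)\<^sup>2"
  using kappa_parts_bound[of n] assms by (simp add: kappa_sym_group)

end
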